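(* Suppose that $f+\Phi$ is bounded from below and that the parameters satisfy $$2\gamma L(|1-a|+\gamma L)+|1-a|+\gamma L+b\gamma L<1,\qquad ab+\tfrac{a}{2}+\tfrac12 a|1-a|+\tfrac12\gamma aL+\tfrac12\gamma abL<b.$$ For $x_0,y_0\in\mathbb{R}^n$, let $(x,y)\in C^1([0,+\infty),\mathbb{R}^n)\times C^2([0,+\infty),\mathbb{R}^n)$ be the unique global solution of the dynamical system $$\dot x(t)+x(t)=\operatorname{prox}_{\gamma f}\big[x(t)-\gamma\nabla\Phi(x(t))-ax(t)-by(t)\big],\quad \dot y(t)+ax(t)+by(t)=0,\quad x(0)=x_0,\ y(0)=y_0.$$ Consider the function $$H:\mathbb{R}^n\times\mathbb{R}^n\times\mathbb{R}^n\to\mathbb{R}\cup\{+\infty\},\quad H(u,v,w)=(f+\Phi)(u)+\frac{1}{2\gamma}\|u-v\|^2+\frac{1}{2\gamma a}\|av+bw\|^2.$$ Suppose that $x$ is bounded and that $H$ is a KL function. Then the following statements are true: (a) $\dot x,\dot y,ax+by\in L^1([0,+\infty);\mathbb{R}^n)$ and $\lim_{t\to+\infty}\dot x(t)=\lim_{t\to+\infty}\dot y(t)=\lim_{t\to+\infty}(ax(t)+by(t))=0$; (b) there exists $\overline{x}\in\operatorname{crit}(f+\Phi)$ such that $\lim_{t\to+\infty}x(t)=\overline{x}$ and $\lim_{t\to+\infty}y(t)=-\frac{a}{b}\overline{x}$.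
   Context: Standing setting: $\mathbb{R}^n$ carries the Euclidean inner product and norm; $a,b,\gamma>0$ are real numbers; $f:\mathbb{R}^n\to\mathbb{R}\cup\{+\infty\}$ is proper, convex and lower semicontinuous; $\Phi:\mathbb{R}^n\to\mathbb{R}$ is (possibly nonconvex) Fréchet differentiable with $L$-Lipschitz continuous gradient, $L>0$, i.e. $\|\nabla\Phi(x)-\nabla\Phi(y)\|\le L\|x-y\|$ for all $x,y\in\mathbb{R}^n$. The proximal operator is $\operatorname{prox}_{\gamma f}(y)=\operatorname{argmin}_{u\in\mathbb{R}^n}\{f(u)+\frac{1}{2\gamma}\|u-y\|^2\}$. For every $x_0,y_0$ the system has a unique global solution in $C^1\times C^2$. Subdifferentials: for a proper lower semicontinuous $g:\mathbb{R}^m\to\mathbb{R}\cup\{+\infty\}$ with $\operatorname{dom} g=\{x: g(x)<+\infty\}$, the Fréchet subdifferential at $x\in\operatorname{dom} g$ is $\hat\partial g(x)=\{v:\liminf_{y\to x}\frac{g(y)-g(x)-\langle v,y-x\rangle}{\|y-x\|}\ge 0\}$, and $\hat\partial g(x)=\emptyset$ for $x\notin\operatorname{dom} g$. The limiting subdifferential at $x\in\operatorname{dom} g$ is $\partial g(x)=\{v:\exists x_k\to x,\ g(x_k)\to g(x),\ \exists v_k\in\hat\partial g(x_k),\ v_k\to v\}$, and $\partial g(x)=\emptyset$ for $x\notin\operatorname{dom} g$. $\operatorname{crit}(g)=\{x:0\in\partial g(x)\}$. KL property: for $\eta\in(0,+\infty]$, $\Theta_\eta$ is the class of concave continuous functions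 $\varphi:[0,\eta)\to[0,+\infty)$ with $\varphi(0)=0$, $\varphi$ continuously differentiable on $(0,\eta)$ and $\varphi'(s)>0$ for all $s\in(0,\eta)$. A proper lower semicontinuous $g$ satisfies the Kurdyka-Łojasiewicz (KL) property at $\overline{x}\in\operatorname{dom}\partial g=\{x:\partial g(x)\ne\emptyset\}$ if there exist $\eta\in(0,+\infty]$, a neighborhood $U$ of $\overline{x}$ and $\varphi\in\Theta_\eta$ such that $\varphi'(g(x)-g(\overline{x}))\operatorname{dist}(0,\partial g(x))\ge 1$ for all $x\in U$ with $g(\overline{x})<g(x)<g(\overline{x})+\eta$, where $\operatorname{dist}(x,A)=\inf_{y\in A}\|x-y\|$. $g$ is a KL function if it satisfies the KL property at each point of $\operatorname{dom}\partial g$. *)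

theory Defs
  imports "HOL-Analysis.Analysis"
begin

section \<open>Extended real valued functions\<close>

definition proper_fun :: "('a \<Rightarrow> ereal) \<Rightarrow> bool" where
  "proper_fun g \<longleftrightarrow> (\<forall>x. g x \<noteq> -\<infinity>) \<and> (\<exists>x. g x < \<infinity>)"

definition convex_fun :: "('a::real_vector \<Rightarrow> ereal) \<Rightarrow> bool" where
  "convex_fun g \<longleftrightarrow>
     (\<forall>x y. \<forall>s::real. 0 < s \<and> s < 1 \<longrightarrow>
        g ((1 - s) *\<^sub>R x + s *\<^sub>R y) \<le> ereal (1 - s) * g x + ereal s * g y)"

definition lsc_fun :: "('a::topological_space \<Rightarrow> ereal) \<Rightarrow> bool" where
  "lsc_fun g \<longleftrightarrow> (\<forall>x. g x \<le> Liminf (at x) g)"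

definition edom :: "('a \<Rightarrow> ereal) \<Rightarrow> 'a set" where
  "edom g = {x. g x < \<infinity>}"

text \<open>If \<open>f\<close> is proper, convex and lower semicontinuous on a Euclidean space and \<open>\<gamma> > 0\<close>,
  the minimizer exists and is unique, so the choice made by \<open>arg_min\<close> is immaterial.\<close>

definition prox :: "real \<Rightarrow> ('a::real_inner \<Rightarrow> ereal) \<Rightarrow> 'a \<Rightarrow> 'a" where
  "prox \<gamma> f y = arg_min (\<lambda>u. f u + ereal (1 / (2 * \<gamma>) * (norm (u - y))\<^sup>2)) (\<lambda>_. True)"


section \<open>Subdifferentials and critical points\<close>

text \<open>The definitions in this and the next section are meant for proper lower semicontinuous
  functions \<open>g\<close>; in particular \<open>g x\<close> is finite for \<open>x \<in> edom g\<close>, and no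
  undefined difference of infinities is formed.\<close>

definition frechet_subdiff :: "('a::real_inner \<Rightarrow> ereal) \<Rightarrow> 'a \<Rightarrow> 'a set" where
  "frechet_subdiff g x =
     (if x \<in> edom g
      then {v. Liminf (at x) (\<lambda>y. (g y - g x - ereal (v \<bullet> (y - x))) / ereal (norm (y - x))) \<ge> 0}
      else {})"

definition limiting_subdiff :: "('a::real_inner \<Rightarrow> ereal) \<Rightarrow> 'a \<Rightarrow> 'a set" where
  "limiting_subdiff g x =
     (if x \<in> edom g
      then {v. \<exists>X V. X \<longlonglongrightarrow> x \<and> (\<lambda>k. g (X k)) \<longlonglongrightarrow> g x \<and>
                     (\<forall>k. V k \<in> frechet_subdiff g (X k)) \<and> V \<longlonglongrightarrow> v}
      else {})"

definition crit :: "('a::real_inner \<Rightarrow> ereal) \<Rightarrow> 'a set" where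
  "crit g = {x. 0 \<in> limiting_subdiff g x}"


section \<open>Kurdyka-Lojasiewicz functions\<close>

definition KL_Theta :: "ereal \<Rightarrow> (real \<Rightarrow> real) set" where
  "KL_Theta \<eta> = {\<phi>.
     concave_on {s. 0 \<le> s \<and> ereal s < \<eta>} \<phi> \<and>
     continuous_on {s. 0 \<le> s \<and> ereal s < \<eta>} \<phi> \<and>
     (\<forall>s. 0 \<le> s \<and> ereal s < \<eta> \<longrightarrow> 0 \<le> \<phi> s) \<and>
     \<phi> 0 = 0 \<and>
     (\<forall>s. 0 < s \<and> ereal s < \<eta> \<longrightarrow> \<phi> differentiable (at s)) \<and>
     continuous_on {s. 0 < s \<and> ereal s < \<eta>} (deriv \<phi>) \<and>
     (\<forall>s. 0 < s \<and> ereal s < \<eta> \<longrightarrow> deriv \<phi> s > 0)}"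

text \<open>Unlike \<open>infdist\<close>, which is \<open>0\<close> for the empty set, this infimum is \<open>\<infinity>\<close> there, as
  needed at points with empty subdifferential.\<close>

definition edist_set :: "'a::real_normed_vector \<Rightarrow> 'a set \<Rightarrow> ereal" where
  "edist_set x A = (INF y\<in>A. ereal (norm (x - y)))"

definition KL_property_at :: "('a::real_inner \<Rightarrow> ereal) \<Rightarrow> 'a \<Rightarrow> bool" where
  "KL_property_at g xbar \<longleftrightarrow>
     (\<exists>\<eta> U \<phi>. 0 < \<eta> \<and> open U \<and> xbar \<in> U \<and> \<phi> \<in> KL_Theta \<eta> \<and>
        (\<forall>x\<in>U. g xbar < g x \<and> g x < g xbar + \<eta> \<longrightarrow>
           ereal (deriv \<phi> (real_of_ereal (g x - g xbar))) * edist_set 0 (limiting_subdiff g x) \<ge> 1))"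

definition KL_function :: "('a::real_inner \<Rightarrow> ereal) \<Rightarrow> bool" where
  "KL_function g \<longleftrightarrow> (\<forall>xbar. limiting_subdiff g xbar \<noteq> {} \<longrightarrow> KL_property_at g xbar)"


section \<open>The dynamical system\<close>

text \<open>Trajectories live on \<open>[0, \<infinity>)\<close>; values at negative times are irrelevant, so the
  derivative at \<open>0\<close> is one-sided.\<close>

definition tderiv :: "(real \<Rightarrow> 'a::real_normed_vector) \<Rightarrow> real \<Rightarrow> 'a" where
  "tderiv x t = vector_derivative x (at t within {0..})"

definition C1_halfline :: "(real \<Rightarrow> 'a::real_normed_vector) \<Rightarrow> bool" where
  "C1_halfline x \<longleftrightarrow>
     (\<forall>t\<ge>0. x differentiable (at t within {0..})) \<and> continuous_on {0..} (tderiv x)"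

definition C2_halfline :: "(real \<Rightarrow> 'a::real_normed_vector) \<Rightarrow> bool" where
  "C2_halfline x \<longleftrightarrow> C1_halfline x \<and> C1_halfline (tderiv x)"

definition global_solution ::
  "real \<Rightarrow> real \<Rightarrow> real \<Rightarrow> ('a::real_inner \<Rightarrow> ereal) \<Rightarrow> ('a \<Rightarrow> 'a) \<Rightarrow> 'a \<Rightarrow> 'a \<Rightarrow>
   (real \<Rightarrow> 'a) \<Rightarrow> (real \<Rightarrow> 'a) \<Rightarrow> bool" where
  "global_solution a b \<gamma> f grad\<Phi> x\<^sub>0 y\<^sub>0 x y \<longleftrightarrow>
     C1_halfline x \<and> C2_halfline y \<and>
     (\<forall>t\<ge>0. tderiv x t + x t =
        prox \<gamma> f (x t - \<gamma> *\<^sub>R grad\<Phi> (x t) - a *\<^sub>R x t - b *\<^sub>R y t)) \<and>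
     (\<forall>t\<ge>0. tderiv y t + a *\<^sub>R x t + b *\<^sub>R y t = 0) \<and>
     x 0 = x\<^sub>0 \<and> y 0 = y\<^sub>0"

definition regH ::
  "real \<Rightarrow> real \<Rightarrow> real \<Rightarrow> ('a::real_inner \<Rightarrow> ereal) \<Rightarrow> ('a \<Rightarrow> real) \<Rightarrow> 'a \<times> 'a \<times> 'a \<Rightarrow> ereal" where
  "regH a b \<gamma> f \<Phi> = (\<lambda>(u, v, w).
     (f u + ereal (\<Phi> u)) + ereal (1 / (2 * \<gamma>) * (norm (u - v))\<^sup>2)
       + ereal (1 / (2 * \<gamma> * a) * (norm (a *\<^sub>R v + b *\<^sub>R w))\<^sup>2))"

end

theory Submission
  imports Defs
begin

text \<open>
  The argument is a Lyapunov argument followed by a finite-length argument. Write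
  \<open>p = x + x'\<close>. Along the trajectory the function \<open>H\<close> takes the value
  \<open>energy t = H (p t, x t, y t)\<close>, and the optimality condition of the proximal step says that
  \<open>\<xi> = y' / \<gamma> - grad\<Phi> x - x' / \<gamma>\<close> is a subgradient of \<open>f\<close> at \<open>p\<close>. If everything were
  differentiable, the chain rule would give
  \<open>energy' = (grad\<Phi> p - grad\<Phi> x) \<bullet> p' - \<bar>x'\<bar>\<^sup>2 / \<gamma> + y' \<bullet> (p' - x') / \<gamma> - b \<bar>y'\<bar>\<^sup>2 / (\<gamma> a)\<close>.
  As the proximal map is nonexpansive, \<open>\<bar>p'\<bar> \<le> K \<bar>x'\<bar> + b \<bar>y'\<bar>\<close> with
  \<open>K = \<bar>1 - a\<bar> + \<gamma> L\<close>, and the two parameter inequalities are exactly what makes the resulting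
  quadratic form in \<open>(\<bar>x'\<bar>, \<bar>y'\<bar>)\<close> negative definite after the mixed term is split evenly.

  However, \<open>x'\<close> and \<open>p\<close> are merely locally Lipschitz. Instead of derivatives almost
  everywhere the proof uses upper right Dini derivatives (\<open>right_rate_le\<close>): the subgradient
  inequality bounds the increment of \<open>energy\<close> on \<open>[t, s]\<close> by an expression in \<open>x\<close>, \<open>y\<close> and
  their derivatives whose quotient by \<open>s - t\<close> has a limit (lemmas \<open>energy_increment\<close> and
  \<open>energy_rate\<close>), and a continuous function with a Dini bound decreases at least by the
  integral of that bound (\<open>decrease_by_integral\<close>).

  Since \<open>energy\<close> is bounded below, the squared speed has bounded integrals; being Lipschitz,
  it vanishes at infinity. Boundedness of \<open>x\<close> supplies a cluster point \<open>(xbar, xbar, ybar)\<close> of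
  \<open>(p, x, y)\<close>. The subdifferential of \<open>f\<close> has a closed graph along which the values of \<open>f\<close>
  converge, so \<open>xbar\<close> is critical and \<open>energy\<close> tends to \<open>H (xbar, xbar, ybar)\<close>.

  Finally, \<open>H\<close> has a subgradient at \<open>(p t, x t, y t)\<close> of norm at most a multiple of the speed
  (\<open>subgradient_along_trajectory_bounded_by_speed\<close>). With the desingularizing function \<open>\<phi>\<close> of the KL property at
  the cluster point, \<open>\<phi> (energy - limit)\<close> then decreases at least at a rate proportional to the
  speed itself. Thus the length of the trajectory is controlled by an arbitrarily small number
  as long as it stays near the cluster point, which traps it there (\<open>KL_finite_length\<close>).
\<close>

section \<open>Semicontinuity and subgradients\<close>

lemma lsc_fun_eventually_gt:
  assumes "lsc_fun g" and "c < g x"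
  shows "\<forall>\<^sub>F y in nhds x. c < g y"
  using assms less_LiminfD[of c "at x" g] unfolding lsc_fun_def eventually_nhds_conv_at
  by (meson order_less_le_trans)

text \<open>Lower semicontinuity of a sum with a continuous function, in the form needed for
  compactness arguments: strict superlevel sets are open.\<close>

lemma open_superlevel_sum:
  fixes f :: "'a::topological_space \<Rightarrow> ereal" and k :: "'a \<Rightarrow> real"
  assumes lsc: "lsc_fun f" and fin: "\<And>u. f u \<noteq> -\<infinity>" and k: "continuous_on UNIV k"
  shows "open {u. c < f u + ereal (k u)}"
proof -
  have "\<forall>\<^sub>F y in nhds u. c < f y + ereal (k y)" if u: "c < f u + ereal (k u)" for u
  proof (cases c)
    case (real r)
    have "ereal (r - k u) < f u"
      using u real fin[of u] by (cases "f u") auto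
    then obtain d where d: "ereal (r - k u) < ereal d" "ereal d < f u"
      using ereal_dense2 by blast
    have 1: "\<forall>\<^sub>F y in nhds u. ereal d < f y"
      using lsc d(2) by (rule lsc_fun_eventually_gt)
    have "(k \<longlongrightarrow> k u) (nhds u)"
      using k by (metis UNIV_I continuous_on_def tendsto_at_iff_tendsto_nhds)
    then have 2: "\<forall>\<^sub>F y in nhds u. r - d < k y"
      using d(1) by (intro order_tendstoD(1)) auto
    show ?thesis
      using 1 2
    proof eventually_elim
      case (elim y)
      then show ?case using real fin[of y] by (cases "f y") auto
    qed
  next
    case PInf
    then show ?thesis using u by auto
  next
    case MInf
    have "c < f y + ereal (k y)" for y
      using fin[of y] MInf by (cases "f y") auto
    then show ?thesis by simp
  qed
  then show ?thesis
    by (subst open_subopen) (auto simp: eventually_nhds subset_eq)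
qed

text \<open>If no point were a minimizer, the sets of points beaten by a given competitor would be an open
  cover of the compact sublevel set.\<close>

lemma attains_minimum_if_superlevels_open:
  fixes F :: "'a::heine_borel \<Rightarrow> ereal"
  assumes op: "\<And>c. open {u. c < F u}" and bd: "bounded {u. F u \<le> F u0}"
  shows "\<exists>p. \<forall>u. F p \<le> F u"
proof (rule ccontr)
  assume "\<nexists>p. \<forall>u. F p \<le> F u"
  then have no_min: "\<And>p. \<exists>u. F u < F p" by (meson not_le)
  let ?K = "{u. F u \<le> F u0}"
  have "?K = - {u. F u0 < F u}" by auto
  then have "compact ?K"
    using bd op[of "F u0"] by (simp add: compact_eq_bounded_closed closed_def)
  moreover have "?K \<subseteq> (\<Union>u\<in>UNIV. {q. F u < F q})"
    using no_min by auto
  ultimately obtain D where D: "finite D" "?K \<subseteq> (\<Union>u\<in>D. {q. F u < F q})"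
    using compactE_image[of ?K UNIV "\<lambda>u. {q. F u < F q}"] op by metis
  \<comment> \<open>The best of the finitely many competitors lies in the sublevel set, hence is beaten by
      one of them.\<close>
  obtain m where m: "m \<in> insert u0 D" "\<And>u. u \<in> insert u0 D \<Longrightarrow> F m \<le> F u"
    using arg_min_if_finite[of "insert u0 D" F] D(1) by (metis finite_insert insert_not_empty not_le)
  have "m \<in> ?K" using m(2) by simp
  then obtain u where "u \<in> D" "F u < F m" using D(2) by auto
  then show False using m(2)[of u] by simp
qed

text \<open>For convex functions the Frechet and limiting subdifferentials reduce to this global
  inequality, which is far easier to pass to the limit in.\<close>

definition convex_subgradient :: "('a::real_inner \<Rightarrow> ereal) \<Rightarrow> 'a \<Rightarrow> 'a \<Rightarrow> bool" where
  "convex_subgradient f p v \<longleftrightarrow> (\<forall>u. f p + ereal (v \<bullet> (u - p)) \<le> f u)"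

text \<open>A point with a subgradient lies below a translate of some finite value, so it belongs to the
  domain.\<close>

lemma convex_subgradient_finite:
  assumes "proper_fun f" and "convex_subgradient f p v"
  shows "\<bar>f p\<bar> \<noteq> \<infinity>"
proof -
  obtain u where "f u < \<infinity>" using assms(1) unfolding proper_fun_def by auto
  moreover have "f p + ereal (v \<bullet> (u - p)) \<le> f u"
    using assms(2) unfolding convex_subgradient_def by auto
  ultimately have "f p \<noteq> \<infinity>" by auto
  then show ?thesis using assms(1) unfolding proper_fun_def by (cases "f p") auto
qed

lemma convex_subgradient_real:
  assumes "proper_fun f" and "convex_subgradient f p v" and "convex_subgradient f q w"
  shows "real_of_ereal (f p) + v \<bullet> (q - p) \<le> real_of_ereal (f q)"
proof -
  have "f p + ereal (v \<bullet> (q - p)) \<le> f q"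
    using assms(2) unfolding convex_subgradient_def by auto
  then show ?thesis
    using convex_subgradient_finite[OF assms(1,2)] convex_subgradient_finite[OF assms(1,3)]
    by (cases "f p"; cases "f q") auto
qed

lemma convex_subgradient_monotone:
  assumes "proper_fun f" and "convex_subgradient f p v" and "convex_subgradient f q w"
  shows "0 \<le> (v - w) \<bullet> (p - q)"
  using convex_subgradient_real[OF assms] convex_subgradient_real[OF assms(1,3,2)]
  by (simp add: inner_diff_left inner_diff_right)

text \<open>Semicontinuity alone only bounds the limit of the values from below. The subgradients at
  the approximating points, tested against the limit point, supply the reverse bound; it is this
  convergence of values that later identifies the limit of the energy.\<close>

lemma convex_subgradient_closed:
  fixes f :: "'a::real_inner \<Rightarrow> ereal" and P V :: "nat \<Rightarrow> 'a"
  assumes f: "proper_fun f" "lsc_fun f"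
    and sub: "\<And>k. convex_subgradient f (P k) (V k)"
    and P: "P \<longlonglongrightarrow> p" and V: "V \<longlonglongrightarrow> v"
  shows "convex_subgradient f p v"
    and "(\<lambda>k. real_of_ereal (f (P k))) \<longlonglongrightarrow> real_of_ereal (f p)"
proof -
  have fin: "\<bar>f (P k)\<bar> \<noteq> \<infinity>" for k
    using f(1) sub by (rule convex_subgradient_finite)
  have gt: "\<forall>\<^sub>F k in sequentially. c < f (P k)" if "c < f p" for c
    using lsc_fun_eventually_gt[OF f(2) that] P unfolding filterlim_iff by blast
  show sg: "convex_subgradient f p v"
    unfolding convex_subgradient_def
  proof
    fix u
    show "f p + ereal (v \<bullet> (u - p)) \<le> f u"
    proof (cases "f u = \<infinity>")
      case False
      then obtain r where r: "f u = ereal r"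
        using f(1) unfolding proper_fun_def by (cases "f u") auto
      have "f p \<le> ereal (r - v \<bullet> (u - p))"
      proof (rule ccontr)
        assume "\<not> f p \<le> ereal (r - v \<bullet> (u - p))"
        then obtain c where c: "r - v \<bullet> (u - p) < c" "ereal c < f p"
          using ereal_dense2[of "ereal (r - v \<bullet> (u - p))" "f p"] by (auto simp: not_le)
        have "(\<lambda>k. r - V k \<bullet> (u - P k)) \<longlonglongrightarrow> r - v \<bullet> (u - p)"
          using P V by (intro tendsto_intros)
        then have "\<forall>\<^sub>F k in sequentially. r - V k \<bullet> (u - P k) < c"
          using c(1) by (rule order_tendstoD(2))
        with gt[OF c(2)] have "\<forall>\<^sub>F k in sequentially. False"
        proof eventually_elim
          case (elim k)
          have "f (P k) + ereal (V k \<bullet> (u - P k)) \<le> f u"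
            using sub unfolding convex_subgradient_def by auto
          then show False using elim r fin[of k] by (cases "f (P k)") auto
        qed
        then show False by simp
      qed
      then show ?thesis using r by (cases "f p") auto
    qed simp
  qed
  have finp: "\<bar>f p\<bar> \<noteq> \<infinity>" using f(1) sg by (rule convex_subgradient_finite)
  show "(\<lambda>k. real_of_ereal (f (P k))) \<longlonglongrightarrow> real_of_ereal (f p)"
  proof (rule order_tendstoI)
    fix c assume "c < real_of_ereal (f p)"
    then have "ereal c < f p" using finp by (cases "f p") auto
    from gt[OF this] show "\<forall>\<^sub>F k in sequentially. c < real_of_ereal (f (P k))"
    proof eventually_elim
      case (elim k)
      then show ?case using fin[of k] by (cases "f (P k)") auto
    qed
  next
    fix c assume c: "real_of_ereal (f p) < c"
    have "(\<lambda>k. real_of_ereal (f p) - V k \<bullet> (p - P k)) \<longlonglongrightarrow> real_of_ereal (f p) - v \<bullet> (p - p)"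
      using P V by (intro tendsto_intros)
    then have "\<forall>\<^sub>F k in sequentially. real_of_ereal (f p) - V k \<bullet> (p - P k) < c"
      using c by (intro order_tendstoD(2)) auto
    then show "\<forall>\<^sub>F k in sequentially. real_of_ereal (f (P k)) < c"
    proof eventually_elim
      case (elim k)
      show ?case
        using convex_subgradient_real[OF f(1) sub sg, of k] elim by linarith
    qed
  qed
qed

text \<open>Subgradients of a convex function plus a smooth one come with an error that is quadratic in the
  distance. Divided by the distance it tends to zero, which is all the Frechet
  subdifferential asks for.\<close>

lemma frechet_subdiff_if_quadratic_minorant:
  fixes g :: "'a::real_inner \<Rightarrow> ereal"
  assumes fin: "\<bar>g p\<bar> \<noteq> \<infinity>"
    and minor: "\<And>u. g p + ereal (v \<bullet> (u - p) - C * (norm (u - p))\<^sup>2) \<le> g u"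
  shows "v \<in> frechet_subdiff g p"
proof -
  obtain r where r: "g p = ereal r" using fin by (cases "g p") auto
  have "0 \<le> Liminf (at p) (\<lambda>y. (g y - g p - ereal (v \<bullet> (y - p))) / ereal (norm (y - p)))"
    unfolding le_Liminf_iff
  proof safe
    fix c :: ereal assume c: "c < 0"
    then obtain d where d: "c < ereal d" "d < 0"
      using ereal_dense2[of c 0] by auto
    have "((\<lambda>y. - C * norm (y - p)) \<longlongrightarrow> - C * norm (p - p)) (at p)"
      by (intro tendsto_intros)
    then have "\<forall>\<^sub>F y in at p. d < - C * norm (y - p)"
      using d(2) by (intro order_tendstoD(1)) auto
    moreover have "\<forall>\<^sub>F y in at p. y \<noteq> p"
      by (simp add: eventually_at_filter)
    ultimately show "\<forall>\<^sub>F y in at p. c < (g y - g p - ereal (v \<bullet> (y - p))) / ereal (norm (y - p))"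
    proof eventually_elim
      case (elim y)
      let ?n = "norm (y - p)"
      have n: "?n > 0" using elim by simp
      show ?case
      proof (cases "g y")
        case (real s)
        have "r + (v \<bullet> (y - p) - C * ?n\<^sup>2) \<le> s"
          using minor[of y] real r by simp
        then have "(- C * ?n) * ?n \<le> s - r - v \<bullet> (y - p)"
          by (simp add: power2_eq_square)
        then have "- C * ?n \<le> (s - r - v \<bullet> (y - p)) / ?n"
          using n by (simp add: pos_le_divide_eq)
        then have "d < (s - r - v \<bullet> (y - p)) / ?n" using elim by linarith
        then have "ereal d < (g y - g p - ereal (v \<bullet> (y - p))) / ereal ?n"
          using real r n by simp
        then show ?thesis using d(1) by (rule less_trans[rotated])
      next
        case PInf
        then show ?thesis using r n c by (cases c) (auto simp: divide_ereal_def)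
      next
        case MInf
        then show ?thesis using minor[of y] r by simp
      qed
    qed
  qed
  then show ?thesis
    using r by (simp add: frechet_subdiff_def edom_def)
qed

lemma limiting_subdiff_if_frechet:
  "v \<in> frechet_subdiff g p \<Longrightarrow> v \<in> limiting_subdiff g p"
proof -
  assume v: "v \<in> frechet_subdiff g p"
  then have "p \<in> edom g" unfolding frechet_subdiff_def by (simp split: if_splits)
  moreover have "(\<lambda>_::nat. p) \<longlonglongrightarrow> p \<and> (\<lambda>k::nat. g p) \<longlonglongrightarrow> g p \<and>
      (\<forall>k::nat. v \<in> frechet_subdiff g p) \<and> (\<lambda>_::nat. v) \<longlonglongrightarrow> v"
    using v by simp
  ultimately show ?thesis
    unfolding limiting_subdiff_def
    by (simp, intro exI[of _ "\<lambda>_. p"] exI[of _ "\<lambda>_. v"]) auto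
qed

text \<open>By the mean value theorem on the segment. It yields \<open>L\<close> in place of the sharp constant \<open>L / 2\<close>;
  with \<open>2 \<gamma> L < 1\<close> this error is still dominated by the quadratic term of the proximal objective.\<close>

lemma first_order_error:
  fixes \<Phi> :: "'a::real_inner \<Rightarrow> real"
  assumes grad: "\<And>z. GDERIV \<Phi> z :> grad\<Phi> z"
    and Lip: "\<And>z z'. norm (grad\<Phi> z - grad\<Phi> z') \<le> L * norm (z - z')"
  shows "\<bar>\<Phi> u - \<Phi> p - grad\<Phi> p \<bullet> (u - p)\<bar> \<le> L * (norm (u - p))\<^sup>2"
proof -
  define \<psi> where "\<psi> s = \<Phi> (p + s *\<^sub>R (u - p))" for s :: real
  have D: "(\<Phi> has_derivative (\<lambda>h. h \<bullet> grad\<Phi> z)) (at z)" for z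
    using grad[of z] unfolding gderiv_def .
  have "(\<psi> has_derivative (\<lambda>h. (h *\<^sub>R (u - p)) \<bullet> grad\<Phi> (p + s *\<^sub>R (u - p)))) (at s within {0..1})" for s
  proof -
    have "((\<lambda>s. p + s *\<^sub>R (u - p)) has_derivative (\<lambda>h. h *\<^sub>R (u - p))) (at s within {0..1})"
      by (auto intro!: derivative_eq_intros)
    from has_derivative_compose[OF this D]
    show ?thesis unfolding \<psi>_def .
  qed
  then obtain s where s: "s \<in> {0<..<1}"
    and eq: "\<psi> 1 - \<psi> 0 = ((1 - 0) *\<^sub>R (u - p)) \<bullet> grad\<Phi> (p + s *\<^sub>R (u - p))"
    using mvt_simple[of 0 1 \<psi> "\<lambda>s h. (h *\<^sub>R (u - p)) \<bullet> grad\<Phi> (p + s *\<^sub>R (u - p))"] by auto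
  have "\<Phi> u - \<Phi> p - grad\<Phi> p \<bullet> (u - p) = (grad\<Phi> (p + s *\<^sub>R (u - p)) - grad\<Phi> p) \<bullet> (u - p)"
    unfolding inner_diff_left[of "grad\<Phi> (p + s *\<^sub>R (u - p))"]
    using eq by (simp add: \<psi>_def inner_commute)
  then have "\<bar>\<Phi> u - \<Phi> p - grad\<Phi> p \<bullet> (u - p)\<bar>
      \<le> norm (grad\<Phi> (p + s *\<^sub>R (u - p)) - grad\<Phi> p) * norm (u - p)"
    by (simp add: Cauchy_Schwarz_ineq2)
  also have "\<dots> \<le> (L * norm (s *\<^sub>R (u - p))) * norm (u - p)"
    using Lip[of "p + s *\<^sub>R (u - p)" p] by (intro mult_right_mono) auto
  also have "\<dots> = s * (L * (norm (u - p))\<^sup>2)"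
    using s by (simp add: power2_eq_square)
  also have "\<dots> \<le> 1 * (L * (norm (u - p))\<^sup>2)"
  proof (rule mult_right_mono)
    have "0 \<le> L * norm (u - p)"
      using Lip[of u p] norm_ge_zero order_trans by blast
    then show "0 \<le> L * (norm (u - p))\<^sup>2"
      by (metis mult.assoc mult_nonneg_nonneg norm_ge_zero power2_eq_square)
  qed (use s in auto)
  finally show ?thesis by simp
qed

section \<open>The proximal map\<close>

text \<open>A quadratic lower bound on \<open>f\<close> of curvature less than \<open>1 / \<gamma>\<close> makes the proximal objective
  coercive, so a minimizer exists and the choice made by \<open>arg_min\<close> is one.\<close>

lemma prox_minimizes:
  fixes f :: "'a::euclidean_space \<Rightarrow> ereal"
  assumes f: "proper_fun f" "lsc_fun f" and "\<gamma> > 0"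
    and growth: "\<And>u. ereal (m - k * norm (u - q) - \<kappa> * (norm (u - q))\<^sup>2) \<le> f u"
    and \<kappa>: "2 * \<gamma> * \<kappa> < 1"
  shows "f (prox \<gamma> f q) + ereal (1 / (2 * \<gamma>) * (norm (prox \<gamma> f q - q))\<^sup>2)
          \<le> f u + ereal (1 / (2 * \<gamma>) * (norm (u - q))\<^sup>2)"
proof -
  define F where "F u = f u + ereal (1 / (2 * \<gamma>) * (norm (u - q))\<^sup>2)" for u
  obtain u0 where "f u0 < \<infinity>" using f(1) unfolding proper_fun_def by auto
  then obtain M where M: "F u0 = ereal M"
    using f(1) unfolding proper_fun_def F_def by (cases "f u0") auto
  define \<delta> where "\<delta> = 1 / (2 * \<gamma>) - \<kappa>"
  have \<delta>: "\<delta> > 0"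
    unfolding \<delta>_def using \<kappa> \<open>\<gamma> > 0\<close> by (simp add: field_simps)
  have "bounded {u. F u \<le> F u0}"
  proof (rule boundedI)
    fix u assume "u \<in> {u. F u \<le> F u0}"
    then have "F u \<le> ereal M" using M by simp
    moreover have "ereal (m - k * norm (u - q) - \<kappa> * (norm (u - q))\<^sup>2)
        + ereal (1 / (2 * \<gamma>) * (norm (u - q))\<^sup>2) \<le> F u"
      unfolding F_def using growth by (intro add_right_mono)
    ultimately have "m - k * norm (u - q) - \<kappa> * (norm (u - q))\<^sup>2
        + 1 / (2 * \<gamma>) * (norm (u - q))\<^sup>2 \<le> M"
      by (metis ereal_less_eq(3) order_trans plus_ereal.simps(1))
    then have ineq: "\<delta> * (norm (u - q))\<^sup>2 \<le> (M - m) + k * norm (u - q)"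
      unfolding \<delta>_def by (simp add: algebra_simps)
    have "norm (u - q) \<le> 1 + (\<bar>M - m\<bar> + \<bar>k\<bar>) / \<delta>"
    proof (cases "norm (u - q) \<le> 1")
      case True
      then show ?thesis using \<delta> by (simp add: add_increasing2)
    next
      case False
      let ?n = "norm (u - q)"
      have "M - m \<le> \<bar>M - m\<bar> * ?n"
        using False by (smt (verit) mult_le_cancel_left1 abs_ge_zero)
      moreover have "k * ?n \<le> \<bar>k\<bar> * ?n"
        by (intro mult_right_mono) auto
      ultimately have "(\<delta> * ?n) * ?n \<le> (\<bar>M - m\<bar> + \<bar>k\<bar>) * ?n"
        using ineq by (simp add: power2_eq_square algebra_simps)
      then have "\<delta> * ?n \<le> \<bar>M - m\<bar> + \<bar>k\<bar>"
        using False by (metis mult_right_le_imp_le not_le order_less_trans zero_less_one)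
      then have "?n \<le> (\<bar>M - m\<bar> + \<bar>k\<bar>) / \<delta>"
        using \<delta> by (simp add: pos_le_divide_eq mult.commute)
      then show ?thesis by simp
    qed
    then show "norm u \<le> norm q + (1 + (\<bar>M - m\<bar> + \<bar>k\<bar>) / \<delta>)"
      using norm_triangle_sub[of u q] by linarith
  qed
  moreover have "open {u. c < F u}" for c
    unfolding F_def
    by (rule open_superlevel_sum)
       (use f \<open>\<gamma> > 0\<close> in \<open>auto simp: proper_fun_def intro!: continuous_intros\<close>)
  ultimately obtain p where "\<forall>u. F p \<le> F u"
    using attains_minimum_if_superlevels_open[of F u0] by auto
  then have "is_arg_min F (\<lambda>_. True) p"
    unfolding is_arg_min_def by (simp add: not_less)
  then have "is_arg_min F (\<lambda>_. True) (arg_min F (\<lambda>_. True))"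
    unfolding arg_min_def by (rule someI)
  moreover have "prox \<gamma> f q = arg_min F (\<lambda>_. True)"
    unfolding prox_def F_def ..
  ultimately have "F (prox \<gamma> f q) \<le> F u"
    unfolding is_arg_min_def by (simp add: not_less)
  then show ?thesis unfolding F_def .
qed

text \<open>Fermat's rule for the proximal objective. The quadratic term has no kink, so only its first
  order part survives in the comparison with nearby points of a segment.\<close>

lemma convex_subgradient_if_prox_point:
  fixes f :: "'a::real_inner \<Rightarrow> ereal"
  assumes f: "proper_fun f" "convex_fun f" and "\<gamma> > 0"
    and min: "\<And>u. f p + ereal (1 / (2 * \<gamma>) * (norm (p - q))\<^sup>2)
          \<le> f u + ereal (1 / (2 * \<gamma>) * (norm (u - q))\<^sup>2)"
  shows "convex_subgradient f p ((1 / \<gamma>) *\<^sub>R (q - p))"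
  unfolding convex_subgradient_def
proof
  fix u
  have not_MInf: "f v \<noteq> -\<infinity>" for v using f(1) unfolding proper_fun_def by auto
  obtain u0 where u0: "f u0 < \<infinity>" using f(1) unfolding proper_fun_def by auto
  obtain r where r: "f p = ereal r"
    using min[of u0] u0 not_MInf[of p] not_MInf[of u0] by (cases "f p"; cases "f u0") auto
  show "f p + ereal (((1 / \<gamma>) *\<^sub>R (q - p)) \<bullet> (u - p)) \<le> f u"
  proof (cases "f u")
    case (real R)
    let ?i = "(q - p) \<bullet> (u - p)"
    \<comment> \<open>Compare \<open>p\<close> with the point at parameter \<open>s\<close> on the segment from \<open>p\<close> to \<open>u\<close> and
        divide by \<open>s\<close>.\<close>
    have step: "r + ?i / \<gamma> \<le> R + s * (1 / (2 * \<gamma>) * (norm (u - p))\<^sup>2)" if s: "0 < s" "s < 1" for s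
    proof -
      let ?w = "(1 - s) *\<^sub>R p + s *\<^sub>R u"
      have "f ?w \<le> ereal (1 - s) * f p + ereal s * f u"
        using f(2) s unfolding convex_fun_def by blast
      then have fw: "f ?w \<le> ereal ((1 - s) * r + s * R)" using r real by simp
      have w: "?w - q = (p - q) + s *\<^sub>R (u - p)" by (simp add: algebra_simps)
      have "(norm (?w - q))\<^sup>2 = (norm (p - q))\<^sup>2 - 2 * s * ?i + s\<^sup>2 * (norm (u - p))\<^sup>2"
        unfolding w power2_norm_eq_inner
        by (simp add: inner_add_left inner_add_right inner_diff_left inner_diff_right
            inner_commute power2_eq_square algebra_simps)
      moreover have "r + 1 / (2 * \<gamma>) * (norm (p - q))\<^sup>2
          \<le> ((1 - s) * r + s * R) + 1 / (2 * \<gamma>) * (norm (?w - q))\<^sup>2"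
        using order_trans[OF min[of ?w] add_right_mono[OF fw]] r by simp
      moreover have "s * (r + i / \<gamma>) \<le> s * (R + s * (1 / (2 * \<gamma>) * U))"
        if "r + 1 / (2 * \<gamma>) * P \<le> ((1 - s) * r + s * R) + 1 / (2 * \<gamma>) * W"
          and "W = P - 2 * s * i + s\<^sup>2 * U" for P W U i
        using that \<open>\<gamma> > 0\<close> by (simp add: field_simps power2_eq_square)
      ultimately have "s * (r + ?i / \<gamma>) \<le> s * (R + s * (1 / (2 * \<gamma>) * (norm (u - p))\<^sup>2))"
        by blast
      then show ?thesis using s by simp
    qed
    have "((\<lambda>s. R + s * (1 / (2 * \<gamma>) * (norm (u - p))\<^sup>2))
        \<longlongrightarrow> R + 0 * (1 / (2 * \<gamma>) * (norm (u - p))\<^sup>2)) (at_right 0)"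
      by (intro tendsto_intros)
    moreover have "\<forall>\<^sub>F s in at_right (0::real). s \<in> {0<..<1}"
      by (rule eventually_at_right_real) simp
    then have "\<forall>\<^sub>F s in at_right 0. r + ?i / \<gamma> \<le> R + s * (1 / (2 * \<gamma>) * (norm (u - p))\<^sup>2)"
      by eventually_elim (use step in auto)
    ultimately have "r + ?i / \<gamma> \<le> R + 0 * (1 / (2 * \<gamma>) * (norm (u - p))\<^sup>2)"
      by (intro tendsto_lowerbound) auto
    then show ?thesis using r real by simp
  qed (use not_MInf in auto)
qed

text \<open>Monotonicity of the subdifferential makes the proximal map firmly nonexpansive; the Cauchy-Schwarz
  inequality then gives the Lipschitz constant one.\<close>

lemma prox_step_nonexpansive:
  assumes "proper_fun f" and "\<gamma> > 0"
    and "convex_subgradient f p ((1 / \<gamma>) *\<^sub>R (q - p))"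
    and "convex_subgradient f p' ((1 / \<gamma>) *\<^sub>R (q' - p'))"
  shows "norm (p - p') \<le> norm (q - q')"
proof -
  have "0 \<le> (1 / \<gamma>) * (((q - p) - (q' - p')) \<bullet> (p - p'))"
    using convex_subgradient_monotone[OF assms(1,3,4)]
    by (simp add: scaleR_diff_right[symmetric] del: scaleR_diff_right)
  then have "0 \<le> ((q - p) - (q' - p')) \<bullet> (p - p')"
    using \<open>\<gamma> > 0\<close> by (simp add: zero_le_divide_iff)
  then have "(norm (p - p'))\<^sup>2 \<le> (q - q') \<bullet> (p - p')"
    unfolding power2_norm_eq_inner by (simp add: inner_diff_left inner_diff_right)
  also have "\<dots> \<le> norm (q - q') * norm (p - p')" by (rule norm_cauchy_schwarz)
  finally show ?thesis
    by (cases "p = p'") (simp_all add: power2_eq_square)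
qed

section \<open>Differential inequalities with Dini derivatives\<close>

text \<open>The upper right Dini derivative of \<open>h\<close> at \<open>t\<close> is at most \<open>d\<close>.\<close>

definition right_rate_le :: "(real \<Rightarrow> real) \<Rightarrow> real \<Rightarrow> real \<Rightarrow> bool" where
  "right_rate_le h t d \<longleftrightarrow>
     (\<forall>\<epsilon>>0. \<forall>\<^sub>F s in at_right t. h s - h t \<le> (d + \<epsilon>) * (s - t))"

lemma right_rate_leI:
  assumes bound: "\<And>s. t < s \<Longrightarrow> h s - h t \<le> B s"
    and lim: "((\<lambda>s. B s / (s - t)) \<longlongrightarrow> l) (at_right t)" and "l \<le> d"
  shows "right_rate_le h t d"
  unfolding right_rate_le_def
proof safe
  fix \<epsilon> :: real assume "0 < \<epsilon>"
  then have "\<forall>\<^sub>F s in at_right t. B s / (s - t) < d + \<epsilon>"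
    using lim \<open>l \<le> d\<close> by (intro order_tendstoD(2)[OF lim]) auto
  moreover have "\<forall>\<^sub>F s in at_right t. t < s"
    by (simp add: eventually_at_filter)
  ultimately show "\<forall>\<^sub>F s in at_right t. h s - h t \<le> (d + \<epsilon>) * (s - t)"
  proof eventually_elim
    case (elim s)
    then have "B s \<le> (d + \<epsilon>) * (s - t)" by (simp add: pos_divide_less_eq)
    then show ?case using bound[of s] elim by simp
  qed
qed

lemma right_rate_le_mono:
  assumes "right_rate_le h t d" and "d \<le> d'"
  shows "right_rate_le h t d'"
  unfolding right_rate_le_def
proof safe
  fix \<epsilon> :: real assume "0 < \<epsilon>"
  then have "\<forall>\<^sub>F s in at_right t. h s - h t \<le> (d + \<epsilon>) * (s - t)"
    using assms(1) unfolding right_rate_le_def by blast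
  moreover have "\<forall>\<^sub>F s in at_right t. t < s"
    by (simp add: eventually_at_filter)
  ultimately show "\<forall>\<^sub>F s in at_right t. h s - h t \<le> (d' + \<epsilon>) * (s - t)"
  proof eventually_elim
    case (elim s)
    have "(d + \<epsilon>) * (s - t) \<le> (d' + \<epsilon>) * (s - t)"
      using elim assms(2) by (intro mult_right_mono) auto
    then show ?case using elim by linarith
  qed
qed

text \<open>With slack \<open>\<epsilon>\<close>, the set of times up to \<open>t\<close> at which \<open>h\<close> lies below the line of slope \<open>\<epsilon>\<close> from its
  starting point is compact, and the rate bound at its last element would produce a later one.\<close>

lemma nonincreasing_if_right_rate_le_0:
  assumes "s \<le> t" and cont: "continuous_on {s..t} h"
    and rate: "\<And>r. s \<le> r \<Longrightarrow> r < t \<Longrightarrow> right_rate_le h r 0"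
  shows "h t \<le> h s"
proof -
  have le: "h t \<le> h s + \<epsilon> * (t - s)" if "\<epsilon> > 0" for \<epsilon>
  proof -
    define S where "S = {r \<in> {s..t}. h r \<le> h s + \<epsilon> * (r - s)}"
    have "closed S"
      unfolding S_def
      by (intro continuous_closed_preimage_constant continuous_on_closed_Collect_le)
         (auto intro!: continuous_intros cont)
    moreover have "bounded S"
      unfolding S_def by (rule bounded_subset[of "{s..t}"]) auto
    ultimately have "compact S" by (simp add: compact_eq_bounded_closed)
    moreover have "s \<in> S" using \<open>s \<le> t\<close> by (simp add: S_def)
    ultimately obtain c where c: "c \<in> S" "\<And>r. r \<in> S \<Longrightarrow> r \<le> c"
      using compact_attains_sup[of S] by blast
    have "c = t"
    proof (rule ccontr)
      assume "c \<noteq> t"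
      then have "s \<le> c" "c < t" using c(1) by (auto simp: S_def)
      then have "\<forall>\<^sub>F r in at_right c. h r - h c \<le> (0 + \<epsilon>) * (r - c)"
        using rate that unfolding right_rate_le_def by blast
      moreover have "\<forall>\<^sub>F r in at_right c. r \<in> {c<..<t}"
        using \<open>c < t\<close> by (rule eventually_at_right_real)
      ultimately have "\<forall>\<^sub>F r in at_right c. r \<in> S \<and> c < r"
      proof eventually_elim
        case (elim r)
        have "h c \<le> h s + \<epsilon> * (c - s)" using c(1) by (simp add: S_def)
        then have "h r \<le> h s + \<epsilon> * (r - s)"
          using elim(1) by (simp add: algebra_simps)
        then show ?case using elim(2) \<open>s \<le> c\<close> by (simp add: S_def)
      qed
      then obtain r where "r \<in> S" "c < r"
        using eventually_happens'[OF trivial_limit_at_right_real] by blast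
      then show False using c(2) by fastforce
    qed
    then show ?thesis using c(1) by (simp add: S_def)
  qed
  have "((\<lambda>\<epsilon>. h s + \<epsilon> * (t - s)) \<longlongrightarrow> h s + 0 * (t - s)) (at_right 0)"
    by (intro tendsto_intros)
  moreover have "\<forall>\<^sub>F \<epsilon> in at_right (0::real). h t \<le> h s + \<epsilon> * (t - s)"
    using le by (simp add: eventually_at_filter)
  ultimately have "h t \<le> h s + 0 * (t - s)"
    by (intro tendsto_lowerbound) auto
  then show ?thesis by simp
qed

text \<open>Adding the integral of \<open>g\<close>, which is differentiable because \<open>g\<close> is continuous, reduces this to a
  right rate of zero.\<close>

lemma decrease_by_integral:
  assumes "s \<le> t" and h: "continuous_on {s..t} h" and g: "continuous_on {s..t} g"
    and rate: "\<And>r. s \<le> r \<Longrightarrow> r < t \<Longrightarrow> right_rate_le h r (- g r)"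
  shows "h t + integral {s..t} g \<le> h s"
proof -
  define G where "G r = integral {s..r} g" for r
  have dG: "(G has_real_derivative g r) (at r within {s..t})" if "r \<in> {s..t}" for r
    unfolding G_def using g that by (rule integral_has_real_derivative)
  have "h t + G t \<le> h s + G s"
  proof (rule nonincreasing_if_right_rate_le_0[OF \<open>s \<le> t\<close>])
    show "continuous_on {s..t} (\<lambda>r. h r + G r)"
      by (intro continuous_on_add h DERIV_continuous_on[OF dG])
  next
    fix r assume r: "s \<le> r" "r < t"
    show "right_rate_le (\<lambda>r. h r + G r) r 0"
      unfolding right_rate_le_def
    proof safe
      fix \<epsilon> :: real assume "0 < \<epsilon>"
      have 1: "\<forall>\<^sub>F r' in at_right r. h r' - h r \<le> (- g r + \<epsilon>/2) * (r' - r)"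
        using rate[OF r] \<open>0 < \<epsilon>\<close> unfolding right_rate_le_def by (meson half_gt_zero)
      have "(G has_real_derivative g r) (at r within {r..t})"
        using r by (intro DERIV_subset[OF dG]) auto
      then have "(G has_real_derivative g r) (at_right r)"
        using r(2) by (metis at_within_Icc_at_right)
      then have "((\<lambda>r'. (G r' - G r) / (r' - r)) \<longlongrightarrow> g r) (at_right r)"
        unfolding has_field_derivative_iff .
      then have 2: "\<forall>\<^sub>F r' in at_right r. (G r' - G r) / (r' - r) < g r + \<epsilon>/2"
        using \<open>0 < \<epsilon>\<close> by (intro order_tendstoD(2)) auto
      have 3: "\<forall>\<^sub>F r' in at_right r. r < r'"
        by (simp add: eventually_at_filter)
      from 1 2 3 show "\<forall>\<^sub>F r' in at_right r. h r' + G r' - (h r + G r) \<le> (0 + \<epsilon>) * (r' - r)"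
      proof eventually_elim
        case (elim r')
        then have "G r' - G r \<le> (g r + \<epsilon>/2) * (r' - r)" by (simp add: pos_divide_less_eq)
        moreover have "(- g r + \<epsilon>/2) * (r' - r) + (g r + \<epsilon>/2) * (r' - r) = (0 + \<epsilon>) * (r' - r)"
          by (simp flip: distrib_right)
        ultimately show ?case using elim(1) by linarith
      qed
    qed
  qed
  then show ?thesis by (simp add: G_def)
qed

lemma norm_diff_le_integral_speed:
  fixes X :: "real \<Rightarrow> 'a::banach"
  assumes "s \<le> t" and X: "\<And>r. r \<in> {s..t} \<Longrightarrow> (X has_vector_derivative X' r) (at r within {s..t})"
    and c: "continuous_on {s..t} X'" "continuous_on {s..t} g"
    and le: "\<And>r. r \<in> {s..t} \<Longrightarrow> norm (X' r) \<le> g r"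
  shows "norm (X t - X s) \<le> integral {s..t} g"
proof -
  have "integral {s..t} X' = X t - X s"
    using fundamental_theorem_of_calculus[OF \<open>s \<le> t\<close> X] by (rule integral_unique)
  moreover have "norm (integral {s..t} X') \<le> integral {s..t} g"
    using c le by (intro integral_norm_bound_integral integrable_continuous_interval)
  ultimately show ?thesis by simp
qed

section \<open>Integrability and decay at infinity\<close>

lemma absolutely_integrable_if_speed_integrals_bounded:
  fixes X :: "real \<Rightarrow> 'a::euclidean_space"
  assumes X: "continuous_on {0..} X" and g: "continuous_on {0..} g"
    and le: "\<And>t. 0 \<le> t \<Longrightarrow> norm (X t) \<le> g t"
    and bd: "\<And>t. 0 \<le> t \<Longrightarrow> integral {0..t} g \<le> B"
  shows "X absolutely_integrable_on {0..}"
proof -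
  have int: "g integrable_on {0..t}" for t
    by (rule integrable_continuous_interval) (rule continuous_on_subset[OF g], auto)
  have nn: "0 \<le> g t" if "0 \<le> t" for t
    using le[OF that] norm_ge_zero order_trans by blast
  define G where "G t = integral {0..t} g" for t
  have "mono G"
    unfolding G_def using int nn by (auto intro!: monoI integral_subset_le)
  have le_B: "G t \<le> max B 0" for t
    using bd[of t] unfolding G_def by (cases "0 \<le> t") auto
  then have bdd: "bdd_above (range G)" by (rule bdd_aboveI2)
  have "(G \<longlongrightarrow> (SUP t. G t)) at_top"
  proof (rule increasing_tendsto)
    show "\<forall>\<^sub>F t in at_top. G t \<le> (SUP t. G t)"
      using bdd by (intro always_eventually allI cSUP_upper) auto
  next
    fix c assume "c < (SUP t. G t)"
    then obtain T where "c < G T"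
      using less_cSUP_iff[OF UNIV_not_empty bdd] by blast
    then have "\<forall>t\<ge>T. c < G t"
      using monoD[OF \<open>mono G\<close>] by (meson order_less_le_trans)
    then show "\<forall>\<^sub>F t in at_top. c < G t"
      unfolding eventually_at_top_linorder by blast
  qed
  then have "(g has_integral (SUP t. G t)) {0..}"
    using int nn unfolding G_def by (intro has_integral_to_inf)
  then have "g integrable_on {0..}" by blast
  then show ?thesis
    using X le
    by (intro measurable_bounded_by_integrable_imp_absolutely_integrable[where g=g]
        continuous_imp_measurable_on_sets_lebesgue) auto
qed

text \<open>Barbalat's lemma: a large value of a Lipschitz function persists for a fixed length of time, and
  bounded integrals leave no room for this to happen arbitrarily late.\<close>

lemma vanishes_at_infinity_if_Lipschitz_and_integrals_bounded:
  fixes g :: "real \<Rightarrow> real"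
  assumes Lip: "\<And>s t. 0 \<le> s \<Longrightarrow> s \<le> t \<Longrightarrow> \<bar>g t - g s\<bar> \<le> \<Lambda> * (t - s)"
    and nn: "\<And>t. 0 \<le> t \<Longrightarrow> 0 \<le> g t" and c: "continuous_on {0..} g"
    and bd: "\<And>t. 0 \<le> t \<Longrightarrow> integral {0..t} g \<le> B"
  shows "(g \<longlongrightarrow> 0) at_top"
proof (rule tendstoI)
  fix e :: real assume e: "0 < e"
  have \<Lambda>: "0 \<le> \<Lambda>" using Lip[of 0 1] by auto
  define d where "d = e / (2 * (\<Lambda> + 1))"
  have d: "0 < d" "\<Lambda> * d < e / 2"
    using e \<Lambda> by (auto simp: d_def field_simps)
  define G where "G t = integral {0..t} g" for t
  have int: "g integrable_on {s..t}" if "0 \<le> s" for s t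
    by (rule integrable_continuous_interval) (rule continuous_on_subset[OF c], use that in auto)
  have diff: "G t - G s = integral {s..t} g" if "0 \<le> s" "s \<le> t" for s t
    using Henstock_Kurzweil_Integration.integral_combine[of 0 s t g] int that
    unfolding G_def by simp
  have mono: "G s \<le> G t" if "0 \<le> s" "s \<le> t" for s t
  proof -
    have "0 \<le> integral {s..t} g"
      using nn that int by (intro Henstock_Kurzweil_Integration.integral_nonneg) auto
    then show ?thesis using diff[OF that] by simp
  qed
  \<comment> \<open>Past the time \<open>T\<close> where \<open>G\<close> has nearly reached its supremum, a value \<open>g t \<ge> e\<close> would
      persist above \<open>e / 2\<close> on an interval of length \<open>d\<close> and push \<open>G\<close> above it.\<close>
  have bdd: "bdd_above (G ` {0..})"
    using bd by (auto simp: G_def intro!: bdd_aboveI2)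
  have "(SUP t\<in>{0..}. G t) - d * e / 2 < (SUP t\<in>{0..}. G t)" using d e by simp
  then obtain T where T: "0 \<le> T" "(SUP t\<in>{0..}. G t) - d * e / 2 < G T"
    using less_cSUP_iff[OF _ bdd] by auto
  have "g t < e" if "T \<le> t" for t
  proof (rule ccontr)
    assume "\<not> g t < e"
    have t0: "0 \<le> t" using T that by simp
    have "e / 2 \<le> g s" if "s \<in> {t..t + d}" for s
    proof -
      have "\<Lambda> * (s - t) \<le> \<Lambda> * d" using that \<Lambda> by (intro mult_left_mono) auto
      then show ?thesis using Lip[of t s] t0 that d(2) \<open>\<not> g t < e\<close> by auto
    qed
    then have "integral {t..t + d} (\<lambda>_. e / 2) \<le> integral {t..t + d} g"
      using t0 int by (intro integral_le) auto
    then have "d * e / 2 \<le> G (t + d) - G t"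
      using d diff[of t "t + d"] t0 by simp
    moreover have "G (t + d) \<le> (SUP t\<in>{0..}. G t)"
      using bdd d t0 by (intro cSUP_upper) auto
    moreover have "G T \<le> G t" using mono T that by simp
    ultimately show False using T(2) by linarith
  qed
  then have "\<forall>\<^sub>F t in at_top. g t < e"
    unfolding eventually_at_top_linorder by blast
  moreover have "\<forall>\<^sub>F t in at_top. 0 \<le> g t"
    using nn unfolding eventually_at_top_linorder by blast
  ultimately show "\<forall>\<^sub>F t in at_top. dist (g t) 0 < e"
    by eventually_elim (simp add: dist_real_def)
qed

section \<open>Finite length of trajectories under the KL inequality\<close>

text \<open>Concavity of \<open>\<phi>\<close>. The tangent inequality also covers \<open>r = 0\<close>, where \<open>\<phi>\<close> need not be
  differentiable.\<close>

lemma KL_Theta_tangent: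
  assumes \<phi>: "\<phi> \<in> KL_Theta \<eta>"
    and s: "0 < s" "ereal s < \<eta>" and r: "0 \<le> r" "ereal r < \<eta>"
  shows "\<phi> r - \<phi> s \<le> deriv \<phi> s * (r - s)"
proof -
  define D where "D = {s. 0 \<le> s \<and> ereal s < \<eta>}"
  have concave: "concave_on D \<phi>" and diff: "\<phi> differentiable (at s)"
    using \<phi> s unfolding KL_Theta_def D_def by simp_all
  have "convex D" using concave unfolding concave_on_def by (rule convex_on_imp_convex)
  obtain e where e: "s < e" "ereal e < \<eta>"
    using ereal_dense2[OF s(2)] by auto
  have "{0<..<e} \<subseteq> D"
  proof
    fix x assume "x \<in> {0<..<e}"
    then have "0 < x" "ereal x < ereal e" by auto
    then show "x \<in> D"
      unfolding D_def using e(2) order_less_trans[of "ereal x" "ereal e" \<eta>] by simp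
  qed
  then have "s \<in> interior D"
    using s(1) e(1) by (intro interiorI[of "{0<..<e}"]) auto
  moreover have "(\<phi> has_field_derivative deriv \<phi> s) (at s)"
    using diff by (simp add: DERIV_deriv_iff_real_differentiable)
  then have "((\<lambda>x. - \<phi> x) has_field_derivative - deriv \<phi> s) (at s within D)"
    by (rule DERIV_minus[OF has_field_derivative_at_within])
  moreover have "r \<in> D" using r unfolding D_def by simp
  ultimately have "- deriv \<phi> s * (r - s) \<le> - \<phi> r - (- \<phi> s)"
    using concave unfolding concave_on_def
    by (intro convex_on_imp_above_tangent[of D "\<lambda>x. - \<phi> x"] convex_connected[OF \<open>convex D\<close>])
  then show ?thesis by simp
qed

text \<open>One half of a chain rule for Dini derivatives: concavity replaces differentiability of
  \<open>\<phi> \<circ> h\<close>.\<close>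

lemma right_rate_le_desingularized:
  assumes \<phi>: "\<phi> \<in> KL_Theta \<eta>"
    and h: "right_rate_le h t d" "\<And>s. t < s \<Longrightarrow> 0 \<le> h s \<and> h s \<le> h t"
    and t: "0 < h t" "ereal (h t) < \<eta>"
  shows "right_rate_le (\<lambda>s. \<phi> (h s)) t (deriv \<phi> (h t) * d)"
  unfolding right_rate_le_def
proof safe
  fix \<epsilon> :: real assume "0 < \<epsilon>"
  define D where "D = deriv \<phi> (h t)"
  have D: "0 < D" using \<phi> t unfolding KL_Theta_def D_def by simp
  then have "0 < \<epsilon> / D" using \<open>0 < \<epsilon>\<close> by simp
  then have "\<forall>\<^sub>F s in at_right t. h s - h t \<le> (d + \<epsilon> / D) * (s - t)"
    using h(1) unfolding right_rate_le_def by blast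
  moreover have "\<forall>\<^sub>F s in at_right t. t < s"
    by (simp add: eventually_at_filter)
  ultimately show "\<forall>\<^sub>F s in at_right t. \<phi> (h s) - \<phi> (h t) \<le> (deriv \<phi> (h t) * d + \<epsilon>) * (s - t)"
  proof eventually_elim
    case (elim s)
    have "ereal (h s) < \<eta>"
      using h(2)[OF elim(2)] t(2) order_le_less_trans[of "ereal (h s)" "ereal (h t)" \<eta>] by simp
    then have "\<phi> (h s) - \<phi> (h t) \<le> D * (h s - h t)"
      unfolding D_def using h(2)[OF elim(2)] by (intro KL_Theta_tangent[OF \<phi> t]) auto
    also have "\<dots> \<le> D * ((d + \<epsilon> / D) * (s - t))"
      using elim(1) D by (intro mult_left_mono) auto
    also have "\<dots> = (D * d + \<epsilon>) * (s - t)"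
      using D by (simp add: field_simps)
    finally show ?case unfolding D_def .
  qed
qed

text \<open>The curve \<open>Z\<close> has speed at most \<open>C r\<close>, while \<open>h\<close> (energy above its limit) decreases at least at
  rate \<open>c r\<^sup>2\<close>. Where \<open>\<phi>' (h) M r \<ge> 1\<close>, the quantity \<open>\<phi> (h)\<close> decreases at least at rate \<open>(c / M) r\<close>, so the
  distance travelled after \<open>t0\<close> is at most \<open>(C M / c) \<phi> (h t0)\<close>. Starting close to the cluster
  point and late enough for this to be small, the curve never leaves the neighbourhood of that
  point on which the KL inequality holds. If \<open>h\<close> reaches zero in finite time, \<open>\<phi>' (h)\<close>
  is not available, but then \<open>h\<close> remains zero and the speed vanishes.\<close>

lemma KL_finite_length:
  fixes Z :: "real \<Rightarrow> 'a::metric_space" and r h :: "real \<Rightarrow> real"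
  assumes c: "c > 0" and M: "M > 0" and C: "C > 0"
    and r: "continuous_on {0..} r" "\<And>t. 0 \<le> t \<Longrightarrow> 0 \<le> r t"
    and h: "continuous_on {0..} h" "\<And>t. 0 \<le> t \<Longrightarrow> 0 \<le> h t" "(h \<longlongrightarrow> 0) at_top"
    and rate: "\<And>t. 0 \<le> t \<Longrightarrow> right_rate_le h t (- c * (r t)\<^sup>2)"
    and Z: "\<And>s t. 0 \<le> s \<Longrightarrow> s \<le> t \<Longrightarrow> dist (Z s) (Z t) \<le> C * integral {s..t} r"
    and cluster: "\<And>\<epsilon> T. 0 < \<epsilon> \<Longrightarrow> \<exists>t\<ge>T. dist (Z t) z < \<epsilon>"
    and U: "open U" "z \<in> U" and \<eta>: "0 < \<eta>" and \<phi>: "\<phi> \<in> KL_Theta \<eta>"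
    and KL: "\<And>t. 0 \<le> t \<Longrightarrow> Z t \<in> U \<Longrightarrow> 0 < h t \<Longrightarrow> ereal (h t) < \<eta> \<Longrightarrow>
                1 \<le> deriv \<phi> (h t) * (M * r t)"
  shows "(Z \<longlongrightarrow> z) at_top" and "\<exists>B. \<forall>t\<ge>0. integral {0..t} r \<le> B"
proof -
  have cr: "continuous_on {s..t} r" and ch: "continuous_on {s..t} h" if "0 \<le> s" for s t
    using that by (auto intro: continuous_on_subset[OF r(1)] continuous_on_subset[OF h(1)])
  have int: "r integrable_on {s..t}" if "0 \<le> s" for s t
    using cr[OF that] by (rule integrable_continuous_interval)
  have nn: "0 \<le> integral {s..t} r" if "0 \<le> s" for s t
    using int r(2) that by (intro Henstock_Kurzweil_Integration.integral_nonneg) auto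
  have anti: "h t \<le> h s" if "0 \<le> s" "s \<le> t" for s t
    by (rule nonincreasing_if_right_rate_le_0[OF that(2) ch[OF that(1)]])
       (rule right_rate_le_mono[OF rate], use that c in auto)
  \<comment> \<open>The trapping statement: some tail of the trajectory stays near \<open>z\<close> and has finite length.\<close>
  have trap: "\<exists>t0\<ge>0. \<exists>B. \<forall>t\<ge>t0. dist (Z t) z < \<epsilon> \<and> integral {t0..t} r \<le> B"
    if \<epsilon>: "0 < \<epsilon>" "ball z \<epsilon> \<subseteq> U" for \<epsilon>
  proof (cases "\<exists>T\<ge>0. h T = 0")
    case True
    then obtain T where T: "0 \<le> T" "h T = 0" by blast
    obtain t0 where t0: "T \<le> t0" "dist (Z t0) z < \<epsilon>" using cluster \<epsilon>(1) by blast
    have zero: "integral {t0..t} r \<le> 0" if "t0 \<le> t" for t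
    proof -
      have h0: "h s = 0" if "T \<le> s" for s
        using anti[of T s] h(2)[of s] T that by simp
      have "r s = 0" if "t0 \<le> s" for s
      proof (rule ccontr)
        assume "r s \<noteq> 0"
        \<comment> \<open>A positive speed would make \<open>h\<close> decrease strictly below zero.\<close>
        define e where "e = c * (r s)\<^sup>2 / 2"
        have "e > 0" using \<open>r s \<noteq> 0\<close> c by (simp add: e_def)
        moreover have "0 \<le> s" using T t0 that by simp
        ultimately have "\<forall>\<^sub>F s' in at_right s. h s' - h s \<le> (- c * (r s)\<^sup>2 + e) * (s' - s)"
          using rate unfolding right_rate_le_def by blast
        moreover have "\<forall>\<^sub>F s' in at_right s. s < s'"
          by (simp add: eventually_at_filter)
        ultimately have "\<forall>\<^sub>F s' in at_right s. False"
        proof eventually_elim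
          case (elim s')
          have "0 \<le> - e * (s' - s)"
            using elim h0[of s] h0[of s'] t0 that by (simp add: e_def)
          then show False using \<open>e > 0\<close> elim(2) by (simp add: mult_le_0_iff)
        qed
        then show False by (simp add: trivial_limit_at_right_real)
      qed
      then have "integral {t0..t} r = integral {t0..t} (\<lambda>_. 0)"
        by (intro integral_cong) auto
      then show ?thesis by simp
    qed
    have "dist (Z t) z < \<epsilon>" if "t0 \<le> t" for t
    proof -
      have "C * integral {t0..t} r \<le> 0" using zero[OF that] C by (simp add: mult_le_0_iff)
      then have "dist (Z t0) (Z t) \<le> 0" using Z[of t0 t] T t0 that by linarith
      then show ?thesis using t0(2) by simp
    qed
    then show ?thesis
      using zero T(1) t0(1) by (intro exI[of _ t0] exI[of _ 0] conjI allI impI) auto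
  next
    case False
    then have pos: "0 < h t" if "0 \<le> t" for t
      using h(2)[OF that] that by (auto simp: order_le_less)
    define K where "K = C * (M / c)"
    have K: "K > 0" using c M C by (simp add: K_def)
    \<comment> \<open>A finite \<open>e\<close> below the possibly infinite \<open>\<eta>\<close>; late values of \<open>h\<close> lie in \<open>[0, e]\<close>, a set
        on which \<open>\<phi>\<close> is continuous up to the end points.\<close>
    obtain e where e: "0 < e" "ereal e < \<eta>" using ereal_dense2[OF \<eta>] by auto
    have dom: "{0..e} \<subseteq> {s. 0 \<le> s \<and> ereal s < \<eta>}"
    proof
      fix x assume "x \<in> {0..e}"
      then show "x \<in> {s. 0 \<le> s \<and> ereal s < \<eta>}"
        using e(2) order_le_less_trans[of "ereal x" "ereal e" \<eta>] by simp
    qed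
    have "continuous_on {s. 0 \<le> s \<and> ereal s < \<eta>} \<phi>" and \<phi>0: "\<phi> 0 = 0"
      and "\<forall>s. 0 \<le> s \<and> ereal s < \<eta> \<longrightarrow> 0 \<le> \<phi> s"
      using \<phi> unfolding KL_Theta_def by blast+
    then have c\<phi>: "continuous_on {0..e} \<phi>" and \<phi>nn: "\<And>s. s \<in> {0..e} \<Longrightarrow> 0 \<le> \<phi> s"
      using dom by (blast intro: continuous_on_subset)+
    obtain T1 where T1: "\<And>t. T1 \<le> t \<Longrightarrow> h t < e"
      using order_tendstoD(2)[OF h(3) e(1)] unfolding eventually_at_top_linorder by blast
    have "((\<lambda>t. \<phi> (h t)) \<longlongrightarrow> \<phi> 0) at_top"
    proof (rule continuous_on_tendsto_compose[OF c\<phi> h(3)])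
      show "\<forall>\<^sub>F t in at_top. h t \<in> {0..e}"
        using eventually_ge_at_top[of "max 0 T1"]
      proof eventually_elim
        case (elim t)
        then show ?case using T1[of t] h(2)[of t] by simp
      qed
    qed (use e in auto)
    moreover have "\<phi> 0 < \<epsilon> / 2 / K" using \<phi>0 \<epsilon>(1) K by simp
    ultimately have "\<forall>\<^sub>F t in at_top. \<phi> (h t) < \<epsilon> / 2 / K" by (rule order_tendstoD(2))
    then obtain T2 where T2: "\<And>t. T2 \<le> t \<Longrightarrow> \<phi> (h t) < \<epsilon> / 2 / K"
      unfolding eventually_at_top_linorder by blast
    obtain t0 where t0: "max 0 (max T1 T2) \<le> t0" "dist (Z t0) z < \<epsilon> / 2"
      using cluster[OF half_gt_zero[OF \<epsilon>(1)]] by blast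
    have t0nn: "0 \<le> t0" using t0 by simp
    have small: "K * \<phi> (h t0) < \<epsilon> / 2"
      using T2[of t0] t0 K by (simp add: pos_less_divide_eq mult_ac)
    have inD: "h t \<in> {0..e}" "ereal (h t) < \<eta>" if "t0 \<le> t" for t
    proof -
      show *: "h t \<in> {0..e}" using T1[of t] h(2)[of t] t0 that by auto
      show "ereal (h t) < \<eta>" using * dom by auto
    qed
    have length: "integral {t0..t} r \<le> M / c * \<phi> (h t0)"
      if t: "t0 \<le> t" and inside: "\<And>s. t0 \<le> s \<Longrightarrow> s < t \<Longrightarrow> Z s \<in> U" for t
    proof -
      have "\<phi> (h t) + integral {t0..t} (\<lambda>s. c / M * r s) \<le> \<phi> (h t0)"
      proof (rule decrease_by_integral[OF t])
        have "h ` {t0..t} \<subseteq> {0..e}" using inD by auto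
        then show "continuous_on {t0..t} (\<lambda>s. \<phi> (h s))"
          by (rule continuous_on_compose2[OF c\<phi> ch[OF t0nn]])
        show "continuous_on {t0..t} (\<lambda>s. c / M * r s)"
          using cr[OF t0nn] by (intro continuous_intros)
      next
        fix s assume s: "t0 \<le> s" "s < t"
        have snn: "0 \<le> s" using s t0nn by simp
        let ?D = "deriv \<phi> (h s)"
        have "right_rate_le (\<lambda>s. \<phi> (h s)) s (?D * (- c * (r s)\<^sup>2))"
          using anti[of s] h(2) snn
          by (intro right_rate_le_desingularized[OF \<phi> rate] inD s pos) auto
        moreover have "?D * (- c * (r s)\<^sup>2) \<le> - (c / M * r s)"
        proof -
          have "1 \<le> ?D * (M * r s)"
            using snn s inD pos inside by (intro KL) auto
          then have "c / M * r s * 1 \<le> c / M * r s * (?D * (M * r s))"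
            using c M r(2)[OF snn] by (intro mult_left_mono) auto
          also have "\<dots> = ?D * (c * (r s)\<^sup>2)"
            using M by (simp add: power2_eq_square)
          finally show ?thesis by simp
        qed
        ultimately show "right_rate_le (\<lambda>s. \<phi> (h s)) s (- (c / M * r s))"
          by (rule right_rate_le_mono)
      qed
      then have "c / M * integral {t0..t} r \<le> \<phi> (h t0)"
        using \<phi>nn[OF inD(1)[OF t]] by simp
      then show ?thesis using c M by (simp add: field_simps)
    qed
    have close: "dist (Z t) z < \<epsilon>"
      if t: "t0 \<le> t" and inside: "\<And>s. t0 \<le> s \<Longrightarrow> s < t \<Longrightarrow> Z s \<in> U" for t
    proof -
      have "C * integral {t0..t} r \<le> C * (M / c * \<phi> (h t0))"
        using length[OF t inside] C by (intro mult_left_mono) auto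
      then have "dist (Z t0) (Z t) < \<epsilon> / 2"
        using Z[OF t0nn t] small unfolding K_def mult.assoc by linarith
      then show ?thesis
        using t0(2) dist_triangle[of "Z t" z "Z t0"] by (simp add: dist_commute)
    qed
    \<comment> \<open>At a first exit time from the ball the estimate \<open>close\<close> would still apply.\<close>
    have cZ: "continuous_on {t0..t} Z" for t
    proof -
      have "bdd_above (r ` {t0..t})"
        by (intro bounded_imp_bdd_above compact_imp_bounded compact_continuous_image cr t0nn compact_Icc)
      then obtain R where R: "\<And>s. s \<in> {t0..t} \<Longrightarrow> r s \<le> R"
        unfolding bdd_above_def by blast
      show ?thesis
      proof (rule lipschitz_on_continuous_on)
        show "(C * \<bar>R\<bar>)-lipschitz_on {t0..t} Z"
        proof (rule lipschitz_onI)
          have *: "dist (Z s) (Z s') \<le> C * \<bar>R\<bar> * dist s s'"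
            if "s \<in> {t0..t}" "s' \<in> {t0..t}" "s \<le> s'" for s s'
          proof -
            have "integral {s..s'} r \<le> integral {s..s'} (\<lambda>_. \<bar>R\<bar>)"
              using that t0nn int by (intro integral_le) (auto intro!: order_trans[OF R abs_ge_self])
            then have "C * integral {s..s'} r \<le> C * (\<bar>R\<bar> * (s' - s))"
              using that C by (intro mult_left_mono) (auto simp: mult.commute)
            then show ?thesis
              using Z[of s s'] that t0nn by (simp add: dist_real_def mult.assoc)
          qed
          show "dist (Z s) (Z s') \<le> C * \<bar>R\<bar> * dist s s'"
            if "s \<in> {t0..t}" "s' \<in> {t0..t}" for s s'
            using *[OF that] *[OF that(2,1)] by (cases "s \<le> s'") (simp_all add: dist_commute)
        qed (use C in simp)
      qed
    qed
    have inside: "dist (Z t) z < \<epsilon>" if "t0 \<le> t" for t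
    proof (rule ccontr)
      assume out: "\<not> dist (Z t) z < \<epsilon>"
      define E where "E = {s \<in> {t0..t}. \<epsilon> \<le> dist (Z s) z}"
      have "closed E"
        unfolding E_def
        by (intro continuous_on_closed_Collect_le) (auto intro!: continuous_intros cZ)
      moreover have "bounded E" unfolding E_def by (rule bounded_subset[of "{t0..t}"]) auto
      ultimately have "compact E" by (simp add: compact_eq_bounded_closed)
      moreover have "t \<in> E" using out that by (simp add: E_def)
      ultimately obtain s where s: "s \<in> E" "\<And>s'. s' \<in> E \<Longrightarrow> s \<le> s'"
        using compact_attains_inf[of E] by blast
      have "Z s' \<in> U" if "t0 \<le> s'" "s' < s" for s'
      proof -
        have "s' \<notin> E" using s(2) that by fastforce
        then have "dist (Z s') z < \<epsilon>" using that s(1) by (auto simp: E_def)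
        then show ?thesis using \<epsilon>(2) by (auto simp: dist_commute)
      qed
      then show False using close[of s] s(1) by (auto simp: E_def)
    qed
    have "Z t \<in> U" if "t0 \<le> t" for t
      using inside[OF that] \<epsilon>(2) by (auto simp: dist_commute)
    then have "integral {t0..t} r \<le> M / c * \<phi> (h t0)" if "t0 \<le> t" for t
      using length that by simp
    then show ?thesis using inside t0nn by blast
  qed
  obtain \<epsilon>0 where \<epsilon>0: "0 < \<epsilon>0" "ball z \<epsilon>0 \<subseteq> U" using U openE by blast
  show "(Z \<longlongrightarrow> z) at_top"
  proof (rule tendstoI)
    fix \<epsilon> :: real assume "0 < \<epsilon>"
    then have "0 < min \<epsilon> \<epsilon>0" "ball z (min \<epsilon> \<epsilon>0) \<subseteq> U" using \<epsilon>0 by auto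
    from trap[OF this] show "\<forall>\<^sub>F t in at_top. dist (Z t) z < \<epsilon>"
      unfolding eventually_at_top_linorder by auto
  qed
  obtain t0 B where t0: "0 \<le> t0" "\<And>t. t0 \<le> t \<Longrightarrow> integral {t0..t} r \<le> B"
    using trap[OF \<epsilon>0] by blast
  have "integral {0..t} r \<le> integral {0..t0} r + B" if "0 \<le> t" for t
  proof (cases "t0 \<le> t")
    case True
    then have "integral {0..t} r = integral {0..t0} r + integral {t0..t} r"
      using Henstock_Kurzweil_Integration.integral_combine[of 0 t0 t r] t0(1) int by simp
    then show ?thesis using t0(2)[OF True] by simp
  next
    case False
    then have "integral {0..t0} r = integral {0..t} r + integral {t..t0} r"
      using Henstock_Kurzweil_Integration.integral_combine[of 0 t t0 r] that int by simp
    then show ?thesis using nn[OF that, of t0] t0(2)[of t0] by simp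
  qed
  then show "\<exists>B. \<forall>t\<ge>0. integral {0..t} r \<le> B" by blast
qed

section \<open>Subgradients of the regularized function\<close>

lemma norm_sq_above_tangent:
  fixes P Q :: "'a::real_inner"
  shows "(norm P)\<^sup>2 + 2 * (P \<bullet> (Q - P)) \<le> (norm Q)\<^sup>2"
proof -
  have "(norm Q)\<^sup>2 - ((norm P)\<^sup>2 + 2 * (P \<bullet> (Q - P))) = (norm (Q - P))\<^sup>2"
    unfolding power2_norm_eq_inner by (simp add: inner_diff_left inner_diff_right inner_commute)
  then show ?thesis by (metis zero_le_power2 diff_ge_0_iff_ge)
qed

text \<open>The two penalty terms of \<open>H\<close> are convex quadratics and contribute exact linear minorants; only
  \<open>\<Phi>\<close> causes an error, which is quadratic in the first component.\<close>

lemma frechet_subdiff_regH: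
  fixes f :: "'a::real_inner \<Rightarrow> ereal"
  assumes f: "proper_fun f" and g: "convex_subgradient f u g"
    and grad: "\<And>z. GDERIV \<Phi> z :> grad\<Phi> z"
    and Lip: "\<And>z z'. norm (grad\<Phi> z - grad\<Phi> z') \<le> L * norm (z - z')"
    and pos: "0 < a" "0 < \<gamma>" "0 < L"
  shows "(g + grad\<Phi> u + (1 / \<gamma>) *\<^sub>R (u - v),
          (1 / \<gamma>) *\<^sub>R (a *\<^sub>R v + b *\<^sub>R w) - (1 / \<gamma>) *\<^sub>R (u - v),
          (b / (\<gamma> * a)) *\<^sub>R (a *\<^sub>R v + b *\<^sub>R w)) \<in> frechet_subdiff (regH a b \<gamma> f \<Phi>) (u, v, w)"
proof -
  define e where "e = a *\<^sub>R v + b *\<^sub>R w"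
  let ?V = "(g + grad\<Phi> u + (1 / \<gamma>) *\<^sub>R (u - v),
          (1 / \<gamma>) *\<^sub>R e - (1 / \<gamma>) *\<^sub>R (u - v), (b / (\<gamma> * a)) *\<^sub>R e)"
  obtain r where r: "f u = ereal r"
    using convex_subgradient_finite[OF f g] by (cases "f u") auto
  have "?V \<in> frechet_subdiff (regH a b \<gamma> f \<Phi>) (u, v, w)"
  proof (rule frechet_subdiff_if_quadratic_minorant)
    show "\<bar>regH a b \<gamma> f \<Phi> (u, v, w)\<bar> \<noteq> \<infinity>" using r by (simp add: regH_def)
  next
    fix Y :: "'a \<times> 'a \<times> 'a"
    obtain u' v' w' where Y: "Y = (u', v', w')" by (cases Y)
    show "regH a b \<gamma> f \<Phi> (u, v, w)
        + ereal (?V \<bullet> (Y - (u, v, w)) - L * (norm (Y - (u, v, w)))\<^sup>2) \<le> regH a b \<gamma> f \<Phi> Y"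
    proof (cases "f u'")
      case (real R)
      define e' where "e' = a *\<^sub>R v' + b *\<^sub>R w'"
      have 1: "r + g \<bullet> (u' - u) \<le> R"
        using g r real unfolding convex_subgradient_def by (metis ereal_less_eq(3) plus_ereal.simps(1))
      have "L * (norm (u' - u))\<^sup>2 \<le> L * (norm (Y - (u, v, w)))\<^sup>2"
        using norm_fst_le[of "u' - u" "(v' - v, w' - w)"] pos Y
        by (intro mult_left_mono power_mono) auto
      then have 2: "\<Phi> u + grad\<Phi> u \<bullet> (u' - u) - L * (norm (Y - (u, v, w)))\<^sup>2 \<le> \<Phi> u'"
        using first_order_error[OF grad Lip, of u' u] by linarith
      have "1 / (2 * \<gamma>) * ((norm (u - v))\<^sup>2 + 2 * ((u - v) \<bullet> ((u' - v') - (u - v))))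
          \<le> 1 / (2 * \<gamma>) * (norm (u' - v'))\<^sup>2"
        using pos by (intro mult_left_mono norm_sq_above_tangent) auto
      then have 3: "1 / (2 * \<gamma>) * (norm (u - v))\<^sup>2 + 1 / \<gamma> * ((u - v) \<bullet> ((u' - u) - (v' - v)))
          \<le> 1 / (2 * \<gamma>) * (norm (u' - v'))\<^sup>2"
        by (simp add: distrib_left diff_diff_eq2 algebra_simps)
      have "1 / (2 * \<gamma> * a) * ((norm e)\<^sup>2 + 2 * (e \<bullet> (e' - e))) \<le> 1 / (2 * \<gamma> * a) * (norm e')\<^sup>2"
        using pos by (intro mult_left_mono norm_sq_above_tangent) auto
      moreover have "e' - e = a *\<^sub>R (v' - v) + b *\<^sub>R (w' - w)"
        by (simp add: e_def e'_def algebra_simps)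
      moreover have "1 / (2 * \<gamma> * a) * (N + 2 * (a * i + b * j))
          = 1 / (2 * \<gamma> * a) * N + (1 / \<gamma> * i + b / (\<gamma> * a) * j)" for N i j :: real
        using pos by (simp add: field_simps)
      ultimately have 4: "1 / (2 * \<gamma> * a) * (norm e)\<^sup>2
          + (1 / \<gamma> * (e \<bullet> (v' - v)) + b / (\<gamma> * a) * (e \<bullet> (w' - w))) \<le> 1 / (2 * \<gamma> * a) * (norm e')\<^sup>2"
        by (simp add: inner_add_right del: times_divide_eq_left times_divide_eq_right)
      have "?V \<bullet> (Y - (u, v, w)) = g \<bullet> (u' - u) + grad\<Phi> u \<bullet> (u' - u)
          + 1 / \<gamma> * ((u - v) \<bullet> ((u' - u) - (v' - v)))
          + (1 / \<gamma> * (e \<bullet> (v' - v)) + b / (\<gamma> * a) * (e \<bullet> (w' - w)))"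
        unfolding Y by (simp add: inner_add_left inner_diff_left[of "(1 / \<gamma>) *\<^sub>R e"]
            inner_diff_right[of "u - v" "u' - u"] right_diff_distrib diff_divide_distrib)
      then show ?thesis
        using 1 2 3 4 r real unfolding Y regH_def e_def e'_def by simp
    next
      case PInf
      then show ?thesis unfolding Y regH_def by simp
    next
      case MInf
      then show ?thesis using f unfolding proper_fun_def by simp
    qed
  qed
  then show ?thesis unfolding e_def .
qed

text \<open>The KL inequality freed from extended reals: since the distance of the subdifferential from the origin
  is an infimum, every single subgradient satisfies it.\<close>

lemma KL_property_at_real:
  assumes KL: "KL_property_at g z" and fin: "g z = ereal G"
  shows "\<exists>\<eta> U \<phi>. 0 < \<eta> \<and> open U \<and> z \<in> U \<and> \<phi> \<in> KL_Theta \<eta> \<and>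
    (\<forall>u\<in>U. \<forall>V\<in>limiting_subdiff g u. \<forall>h. g u = ereal (G + h) \<longrightarrow> 0 < h \<longrightarrow> ereal h < \<eta> \<longrightarrow>
        1 \<le> deriv \<phi> h * norm V)"
proof -
  obtain \<eta> U \<phi> where *: "0 < \<eta>" "open U" "z \<in> U" "\<phi> \<in> KL_Theta \<eta>"
    and ineq: "\<And>u. u \<in> U \<Longrightarrow> g z < g u \<Longrightarrow> g u < g z + \<eta> \<Longrightarrow>
        1 \<le> ereal (deriv \<phi> (real_of_ereal (g u - g z))) * edist_set 0 (limiting_subdiff g u)"
    using KL unfolding KL_property_at_def by blast
  have "1 \<le> deriv \<phi> h * norm V"
    if u: "u \<in> U" "g u = ereal (G + h)" and h: "0 < h" "ereal h < \<eta>"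
      and V: "V \<in> limiting_subdiff g u" for u V h
  proof -
    have D: "0 < deriv \<phi> h" using *(4) h unfolding KL_Theta_def by blast
    have "g u < g z + \<eta>" using u(2) fin h(2) by (cases \<eta>) auto
    then have "1 \<le> ereal (deriv \<phi> (real_of_ereal (g u - g z))) * edist_set 0 (limiting_subdiff g u)"
      using u fin h(1) by (intro ineq) auto
    then have "1 \<le> ereal (deriv \<phi> h) * edist_set 0 (limiting_subdiff g u)"
      using u(2) fin by simp
    also have "edist_set 0 (limiting_subdiff g u) \<le> ereal (norm V)"
      unfolding edist_set_def using V by (intro INF_lower2[of V]) auto
    then have "ereal (deriv \<phi> h) * edist_set 0 (limiting_subdiff g u)
        \<le> ereal (deriv \<phi> h) * ereal (norm V)"
      using D by (intro ereal_mult_left_mono) auto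
    finally show ?thesis by simp
  qed
  then show ?thesis using * by blast
qed

section \<open>Energy dissipation along the flow\<close>

locale prox_flow =
  fixes f :: "'a::euclidean_space \<Rightarrow> ereal" and \<Phi> :: "'a \<Rightarrow> real" and grad\<Phi> :: "'a \<Rightarrow> 'a"
    and a b \<gamma> L m :: real and x\<^sub>0 y\<^sub>0 :: 'a and x y :: "real \<Rightarrow> 'a"
  assumes pos: "a > 0" "b > 0" "\<gamma> > 0" "L > 0"
    and f: "proper_fun f" "convex_fun f" "lsc_fun f"
    and grad: "\<And>z. GDERIV \<Phi> z :> grad\<Phi> z"
    and Lip: "\<And>z z'. norm (grad\<Phi> z - grad\<Phi> z') \<le> L * norm (z - z')"
    and lower: "\<And>z. ereal m \<le> f z + ereal (\<Phi> z)"
    and params1: "2 * \<gamma> * L * (\<bar>1 - a\<bar> + \<gamma> * L) + \<bar>1 - a\<bar> + \<gamma> * L + b * \<gamma> * L < 1"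
    and params2: "a * b + a / 2 + 1 / 2 * a * \<bar>1 - a\<bar> + 1 / 2 * \<gamma> * a * L
                    + 1 / 2 * \<gamma> * a * b * L < b"
    and sol: "global_solution a b \<gamma> f grad\<Phi> x\<^sub>0 y\<^sub>0 x y"
begin

text \<open>The point \<open>p t\<close> is the proximal step taken from \<open>q t\<close>; the vector \<open>\<xi> t\<close> is the
  subgradient \<open>(q t - p t) / \<gamma>\<close> of \<open>f\<close> at \<open>p t\<close>, rewritten by means of the second equation. The
  constant \<open>K\<close> is a Lipschitz constant of \<open>q\<close> as a function of \<open>x\<close>.\<close>

definition p :: "real \<Rightarrow> 'a" where "p t = x t + tderiv x t"

definition q :: "real \<Rightarrow> 'a" where "q t = x t - \<gamma> *\<^sub>R grad\<Phi> (x t) - a *\<^sub>R x t - b *\<^sub>R y t"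

definition \<xi> :: "real \<Rightarrow> 'a" where
  "\<xi> t = (1 / \<gamma>) *\<^sub>R tderiv y t - grad\<Phi> (x t) - (1 / \<gamma>) *\<^sub>R tderiv x t"

definition K :: real where "K = \<bar>1 - a\<bar> + \<gamma> * L"

definition speed :: "real \<Rightarrow> real" where "speed t = norm (tderiv x t) + norm (tderiv y t)"

text \<open>The value of \<open>H\<close> at \<open>(p t, x t, y t)\<close>, with \<open>p - x\<close> and \<open>a x + b y\<close> replaced by \<open>x'\<close> and \<open>- y'\<close>.\<close>

definition energy :: "real \<Rightarrow> real" where
  "energy t = real_of_ereal (f (p t)) + \<Phi> (p t) + 1 / (2 * \<gamma>) * (norm (tderiv x t))\<^sup>2
          + 1 / (2 * \<gamma> * a) * (norm (tderiv y t))\<^sup>2"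

lemma K_nonneg: "0 \<le> K" using pos by (simp add: K_def)

text \<open>If \<open>2 \<gamma> L \<ge> 1\<close>, then \<open>2 \<gamma> L K + K \<ge> 2 K \<ge> 2 \<gamma> L \<ge> 1\<close>, against the first parameter condition.\<close>

lemma step_size: "2 * \<gamma> * L < 1"
proof (rule ccontr)
  assume "\<not> 2 * \<gamma> * L < 1"
  then have large: "1 \<le> 2 * (\<gamma> * L)" by simp
  have "1 * K \<le> 2 * (\<gamma> * L) * K" using large K_nonneg by (rule mult_right_mono)
  moreover have "\<gamma> * L \<le> K" by (simp add: K_def)
  moreover have "2 * (\<gamma> * L) * K + K + b * (\<gamma> * L) < 1"
    using params1 by (simp add: K_def mult.assoc)
  moreover have "0 < b * (\<gamma> * L)" using pos by simp
  ultimately show False using large by linarith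
qed

lemma deriv_x: "0 \<le> t \<Longrightarrow> (x has_vector_derivative tderiv x t) (at t within {0..})"
  and deriv_y: "0 \<le> t \<Longrightarrow> (y has_vector_derivative tderiv y t) (at t within {0..})"
  using sol unfolding global_solution_def C2_halfline_def C1_halfline_def tderiv_def
  by (simp_all add: vector_derivative_works)

lemma y'_eq: "0 \<le> t \<Longrightarrow> tderiv y t = - (a *\<^sub>R x t + b *\<^sub>R y t)"
  using sol unfolding global_solution_def
  by (metis (no_types, lifting) add.assoc eq_neg_iff_add_eq_0)

lemma cont_x: "continuous_on {0..} x" and cont_y: "continuous_on {0..} y"
  using deriv_x deriv_y by (auto intro!: continuous_on_vector_derivative)

lemma cont_x': "continuous_on {0..} (tderiv x)" and cont_y': "continuous_on {0..} (tderiv y)"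
  using sol unfolding global_solution_def C2_halfline_def C1_halfline_def by simp_all

lemma cont_grad: "continuous_on S grad\<Phi>"
proof -
  have "L-lipschitz_on S grad\<Phi>"
    using Lip pos by (intro lipschitz_onI) (auto simp: dist_norm)
  then show ?thesis by (rule lipschitz_on_continuous_on)
qed

lemma cont_\<Phi>: "continuous_on S \<Phi>"
  using grad unfolding gderiv_def
  by (intro has_derivative_continuous_on) (auto intro: has_derivative_at_withinI)

lemma cont_p: "continuous_on {0..} p"
  unfolding p_def by (intro continuous_intros cont_x cont_x')

lemma cont_\<xi>: "continuous_on {0..} \<xi>"
  unfolding \<xi>_def
  by (intro continuous_intros cont_x' cont_y' continuous_on_compose2[OF cont_grad cont_x]) auto

lemma cont_speed: "continuous_on {0..} speed"
  unfolding speed_def by (intro continuous_intros cont_x' cont_y')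

lemma speed_nonneg: "0 \<le> speed t" unfolding speed_def by simp

text \<open>The lower bound on \<open>f + \<Phi>\<close>, together with the quadratic upper bound on \<open>\<Phi>\<close> around \<open>u0\<close>, gives \<open>f\<close> the
  growth that the existence of a proximal point needs.\<close>

lemma prox_subgradient: "convex_subgradient f (prox \<gamma> f u0) ((1 / \<gamma>) *\<^sub>R (u0 - prox \<gamma> f u0))"
proof (rule convex_subgradient_if_prox_point[OF f(1,2) pos(3) prox_minimizes[OF f(1,3) pos(3) _ step_size]])
  fix u
  have "\<Phi> u \<le> \<Phi> u0 + grad\<Phi> u0 \<bullet> (u - u0) + L * (norm (u - u0))\<^sup>2"
    using first_order_error[OF grad Lip, of u u0] by linarith
  also have "grad\<Phi> u0 \<bullet> (u - u0) \<le> norm (grad\<Phi> u0) * norm (u - u0)" by (rule norm_cauchy_schwarz)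
  finally have up: "\<Phi> u \<le> \<Phi> u0 + norm (grad\<Phi> u0) * norm (u - u0) + L * (norm (u - u0))\<^sup>2" by simp
  show "ereal ((m - \<Phi> u0) - norm (grad\<Phi> u0) * norm (u - u0) - L * (norm (u - u0))\<^sup>2) \<le> f u"
    using lower[of u] up by (cases "f u") auto
qed

lemma p_eq_prox: "0 \<le> t \<Longrightarrow> p t = prox \<gamma> f (q t)"
  using sol unfolding global_solution_def p_def q_def by (simp add: add.commute)

lemma q_minus_p:
  assumes "0 \<le> t" shows "(1 / \<gamma>) *\<^sub>R (q t - p t) = \<xi> t"
proof -
  have "q t - p t = tderiv y t - \<gamma> *\<^sub>R grad\<Phi> (x t) - tderiv x t"
    unfolding q_def p_def y'_eq[OF assms] by simp
  then show ?thesis using pos by (simp add: \<xi>_def scaleR_diff_right)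
qed

lemma subgradient_p: "0 \<le> t \<Longrightarrow> convex_subgradient f (p t) (\<xi> t)"
  using prox_subgradient[of "q t"] p_eq_prox[of t] q_minus_p[of t] by simp

text \<open>The only control over the increments of \<open>x'\<close> comes from here, as
  \<open>x' = p - x\<close>.\<close>

lemma p_increment:
  assumes "0 \<le> s" "0 \<le> t"
  shows "norm (p s - p t) \<le> K * norm (x s - x t) + b * norm (y s - y t)"
proof -
  have "norm (p s - p t) \<le> norm (q s - q t)"
    using subgradient_p assms q_minus_p
    by (intro prox_step_nonexpansive[OF f(1) pos(3)]) auto
  also have "q s - q t = (1 - a) *\<^sub>R (x s - x t) - \<gamma> *\<^sub>R (grad\<Phi> (x s) - grad\<Phi> (x t)) - b *\<^sub>R (y s - y t)"
    by (simp add: q_def algebra_simps)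
  also have "norm \<dots> \<le> norm ((1 - a) *\<^sub>R (x s - x t)) + norm (\<gamma> *\<^sub>R (grad\<Phi> (x s) - grad\<Phi> (x t)))
      + norm (b *\<^sub>R (y s - y t))"
    by (intro norm_triangle_le_diff add_right_mono norm_triangle_ineq4)
  also have "\<dots> \<le> \<bar>1 - a\<bar> * norm (x s - x t) + \<gamma> * (L * norm (x s - x t)) + b * norm (y s - y t)"
    using pos Lip by (simp add: mult_left_mono)
  finally show ?thesis by (simp add: K_def algebra_simps)
qed

lemma regH_eq_energy:
  assumes "0 \<le> t" shows "regH a b \<gamma> f \<Phi> (p t, x t, y t) = ereal (energy t)"
proof -
  obtain R where "f (p t) = ereal R"
    using convex_subgradient_finite[OF f(1) subgradient_p[OF assms]] by (cases "f (p t)") auto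
  moreover have "norm (a *\<^sub>R x t + b *\<^sub>R y t) = norm (tderiv y t)"
    unfolding y'_eq[OF assms] by (simp only: norm_minus_cancel)
  ultimately show ?thesis
    unfolding regH_def energy_def by (simp add: p_def)
qed

lemma lower_energy:
  assumes "0 \<le> t"
  shows "m + 1 / (2 * \<gamma>) * (norm (tderiv x t))\<^sup>2 + 1 / (2 * \<gamma> * a) * (norm (tderiv y t))\<^sup>2 \<le> energy t"
proof -
  obtain R where "f (p t) = ereal R"
    using convex_subgradient_finite[OF f(1) subgradient_p[OF assms]] by (cases "f (p t)") auto
  then show ?thesis using lower[of "p t"] unfolding energy_def by simp
qed

text \<open>All first order expansions are taken at the later time \<open>s\<close>, for two reasons. Convexity bounds
  \<open>f (p s) - f (p t)\<close> from above only by means of the subgradient at \<open>p s\<close>, and the increments of the squared norms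
  are at most their linearizations at \<open>s\<close>, with no remainder. In the sum the \<open>x'\<close> part of \<open>\<xi> s\<close> cancels against the
  increment of the kinetic term, and \<open>p s - p t\<close> enters only through its norm, which is
  estimated by increments of the differentiable functions \<open>x\<close> and \<open>y\<close>.\<close>

lemma energy_increment:
  assumes t: "0 \<le> t" and s: "t < s"
  shows "energy s - energy t \<le> (L * norm (tderiv x s) + norm (tderiv y s) / \<gamma>)
            * (K * norm (x s - x t) + b * norm (y s - y t))
          - 1 / \<gamma> * (tderiv x s \<bullet> (x s - x t))
          - 1 / (\<gamma> * a) * (tderiv y s \<bullet> (a *\<^sub>R (x s - x t) + b *\<^sub>R (y s - y t)))
          + L * (K * norm (x s - x t) + b * norm (y s - y t))\<^sup>2"
proof -
  have s0: "0 \<le> s" using t s by simp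
  define X Y where "X = tderiv x" and "Y = tderiv y"
  define \<delta> N where "\<delta> = p s - p t" and "N = K * norm (x s - x t) + b * norm (y s - y t)"
  have \<delta>: "norm \<delta> \<le> N" unfolding \<delta>_def N_def using s0 t by (rule p_increment)
  have 1: "real_of_ereal (f (p s)) - real_of_ereal (f (p t)) \<le> \<xi> s \<bullet> \<delta>"
    using convex_subgradient_real[OF f(1) subgradient_p[OF s0] subgradient_p[OF t]]
    by (simp add: \<delta>_def inner_diff_right)
  have 2: "\<Phi> (p s) - \<Phi> (p t) \<le> grad\<Phi> (p s) \<bullet> \<delta> + L * (norm \<delta>)\<^sup>2"
    using first_order_error[OF grad Lip, of "p t" "p s"]
    by (simp add: \<delta>_def inner_diff_right norm_minus_commute abs_le_iff)
  have X: "X s - X t = \<delta> - (x s - x t)" by (simp add: \<delta>_def p_def X_def)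
  have "1 / (2 * \<gamma>) * ((norm (X s))\<^sup>2 + 2 * (X s \<bullet> (X t - X s))) \<le> 1 / (2 * \<gamma>) * (norm (X t))\<^sup>2"
    using pos by (intro mult_left_mono norm_sq_above_tangent) auto
  moreover have "X s \<bullet> (X t - X s) = X s \<bullet> (x s - x t) - X s \<bullet> \<delta>"
    using X by (metis inner_diff_right inner_minus_right minus_diff_eq)
  ultimately have 3: "1 / (2 * \<gamma>) * (norm (X s))\<^sup>2 - 1 / (2 * \<gamma>) * (norm (X t))\<^sup>2
      \<le> 1 / \<gamma> * (X s \<bullet> \<delta>) - 1 / \<gamma> * (X s \<bullet> (x s - x t))"
    using pos by (simp add: field_simps)
  have "1 / (2 * \<gamma> * a) * ((norm (Y s))\<^sup>2 + 2 * (Y s \<bullet> (Y t - Y s))) \<le> 1 / (2 * \<gamma> * a) * (norm (Y t))\<^sup>2"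
    using pos by (intro mult_left_mono norm_sq_above_tangent) auto
  moreover have "Y t - Y s = a *\<^sub>R (x s - x t) + b *\<^sub>R (y s - y t)"
    unfolding Y_def y'_eq[OF s0] y'_eq[OF t] by (simp add: algebra_simps)
  ultimately have "1 / (2 * \<gamma> * a) * ((norm (Y s))\<^sup>2 + 2 * (Y s \<bullet> (a *\<^sub>R (x s - x t) + b *\<^sub>R (y s - y t))))
      \<le> 1 / (2 * \<gamma> * a) * (norm (Y t))\<^sup>2"
    by simp
  moreover have "1 / (2 * \<gamma> * a) * (n + 2 * i) = 1 / (2 * \<gamma> * a) * n + 1 / (\<gamma> * a) * i" for n i
    using pos by (simp add: field_simps)
  ultimately have 4: "1 / (2 * \<gamma> * a) * (norm (Y s))\<^sup>2 - 1 / (2 * \<gamma> * a) * (norm (Y t))\<^sup>2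
      \<le> - (1 / (\<gamma> * a) * (Y s \<bullet> (a *\<^sub>R (x s - x t) + b *\<^sub>R (y s - y t))))"
    by (simp del: times_divide_eq_left times_divide_eq_right)
  have "\<xi> s \<bullet> \<delta> + grad\<Phi> (p s) \<bullet> \<delta> + 1 / \<gamma> * (X s \<bullet> \<delta>)
      = (grad\<Phi> (p s) - grad\<Phi> (x s)) \<bullet> \<delta> + 1 / \<gamma> * (Y s \<bullet> \<delta>)"
    by (simp add: \<xi>_def X_def Y_def inner_diff_left)
  also have "\<dots> \<le> L * norm (X s) * N + 1 / \<gamma> * (norm (Y s) * N)"
  proof (rule add_mono)
    have "(grad\<Phi> (p s) - grad\<Phi> (x s)) \<bullet> \<delta> \<le> norm (grad\<Phi> (p s) - grad\<Phi> (x s)) * norm \<delta>"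
      by (rule norm_cauchy_schwarz)
    also have "\<dots> \<le> L * norm (X s) * N"
      using Lip[of "p s" "x s"] \<delta> pos by (intro mult_mono) (auto simp: p_def X_def)
    finally show "(grad\<Phi> (p s) - grad\<Phi> (x s)) \<bullet> \<delta> \<le> L * norm (X s) * N" .
    have "Y s \<bullet> \<delta> \<le> norm (Y s) * norm \<delta>" by (rule norm_cauchy_schwarz)
    also have "\<dots> \<le> norm (Y s) * N" using \<delta> by (intro mult_left_mono) auto
    finally show "1 / \<gamma> * (Y s \<bullet> \<delta>) \<le> 1 / \<gamma> * (norm (Y s) * N)"
      using pos by (intro mult_left_mono) auto
  qed
  also have "\<dots> = (L * norm (X s) + norm (Y s) / \<gamma>) * N" by (simp add: algebra_simps)
  finally have 5: "\<xi> s \<bullet> \<delta> + grad\<Phi> (p s) \<bullet> \<delta> + 1 / \<gamma> * (X s \<bullet> \<delta>)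
      \<le> (L * norm (X s) + norm (Y s) / \<gamma>) * N" .
  have "L * (norm \<delta>)\<^sup>2 \<le> L * N\<^sup>2"
    using \<delta> pos by (intro mult_left_mono power_mono) auto
  then show ?thesis
    using 1 2 3 4 5 unfolding energy_def X_def[symmetric] Y_def[symmetric] N_def[symmetric] by linarith
qed

text \<open>The two arguments of \<open>min\<close> are the negated coefficients of \<open>\<bar>x'\<bar>\<^sup>2\<close> and \<open>\<bar>y'\<bar>\<^sup>2\<close>
  in the bound for the energy rate after the mixed term is split evenly;
  the two parameter conditions are their positivity. The last factor one half converts the sum of
  squares into the square of the sum.\<close>

definition decay :: real where
  "decay = min ((1 - 2 * \<gamma> * L * K - K - b * \<gamma> * L) / (2 * \<gamma>))
           ((b / a - b - (1 + K + \<gamma> * b * L) / 2) / \<gamma>) / 2"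

lemma decay_pos: "0 < decay"
proof -
  have "2 * \<gamma> * L * K + K + b * \<gamma> * L < 1" using params1 by (simp add: K_def)
  moreover have "a * (b + (1 + K + \<gamma> * b * L) / 2) < b"
    using params2 by (simp add: K_def algebra_simps add_divide_distrib)
  then have "b + (1 + K + \<gamma> * b * L) / 2 < b / a"
    using pos by (simp add: pos_less_divide_eq mult.commute)
  ultimately have "0 < (1 - 2 * \<gamma> * L * K - K - b * \<gamma> * L) / (2 * \<gamma>)"
    and "0 < (b / a - b - (1 + K + \<gamma> * b * L) / 2) / \<gamma>"
    using pos by (intro divide_pos_pos; linarith)+
  then show ?thesis unfolding decay_def by simp
qed

text \<open>The left hand side is the limit of the quotients in the energy estimate, where \<open>X\<close>, \<open>Y\<close> and \<open>i\<close>
  stand for \<open>\<bar>x'\<bar>\<close>, \<open>\<bar>y'\<bar>\<close> and \<open>y' \<bullet> x'\<close>.\<close>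

lemma dissipation:
  fixes X Y i :: real
  assumes X: "0 \<le> X" and Y: "0 \<le> Y" and i: "- i \<le> X * Y"
  shows "(L * X + Y / \<gamma>) * (K * X + b * Y) - 1 / \<gamma> * X\<^sup>2 - 1 / (\<gamma> * a) * (a * i + b * Y\<^sup>2)
      \<le> - decay * (X + Y)\<^sup>2"
proof -
  have XY: "2 * (X * Y) \<le> X\<^sup>2 + Y\<^sup>2" using sum_squares_bound[of X Y] by simp
  let ?c1 = "(1 - 2 * \<gamma> * L * K - K - b * \<gamma> * L) / (2 * \<gamma>)"
  let ?c2 = "(b / a - b - (1 + K + \<gamma> * b * L) / 2) / \<gamma>"
  have "(L * X + Y / \<gamma>) * (K * X + b * Y) - 1 / \<gamma> * X\<^sup>2 - 1 / (\<gamma> * a) * (a * i + b * Y\<^sup>2)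
      = (L * K - 1 / \<gamma>) * X\<^sup>2 + (L * b + K / \<gamma>) * (X * Y) + 1 / \<gamma> * (- i) + (b - b / a) / \<gamma> * Y\<^sup>2"
    using pos by (simp add: field_simps power2_eq_square)
  also have "\<dots> \<le> (L * K - 1 / \<gamma>) * X\<^sup>2 + (L * b + K / \<gamma>) * (X * Y) + 1 / \<gamma> * (X * Y)
      + (b - b / a) / \<gamma> * Y\<^sup>2"
    using i pos by (intro add_right_mono add_left_mono mult_left_mono) auto
  also have "\<dots> = (L * K - 1 / \<gamma>) * X\<^sup>2 + (b - b / a) / \<gamma> * Y\<^sup>2
      + (L * b + K / \<gamma> + 1 / \<gamma>) / 2 * (2 * (X * Y))"
    by (simp add: algebra_simps)
  also have "\<dots> \<le> (L * K - 1 / \<gamma>) * X\<^sup>2 + (b - b / a) / \<gamma> * Y\<^sup>2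
      + (L * b + K / \<gamma> + 1 / \<gamma>) / 2 * (X\<^sup>2 + Y\<^sup>2)"
    using XY pos K_nonneg by (intro add_left_mono mult_left_mono) auto
  also have "\<dots> = - (?c1 * X\<^sup>2 + ?c2 * Y\<^sup>2)"
    using pos by (simp add: field_simps)
  also have "\<dots> \<le> - (2 * decay * X\<^sup>2 + 2 * decay * Y\<^sup>2)"
  proof -
    have "2 * decay \<le> ?c1" "2 * decay \<le> ?c2" unfolding decay_def by simp_all
    then have "2 * decay * X\<^sup>2 \<le> ?c1 * X\<^sup>2" "2 * decay * Y\<^sup>2 \<le> ?c2 * Y\<^sup>2"
      using zero_le_power2 mult_right_mono by blast+
    then show ?thesis by linarith
  qed
  also have "\<dots> = - decay * (X\<^sup>2 + Y\<^sup>2 + (X\<^sup>2 + Y\<^sup>2))" by (simp add: algebra_simps)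
  also have "\<dots> \<le> - decay * (X + Y)\<^sup>2"
    using XY decay_pos by (simp add: power2_sum)
  finally show ?thesis .
qed

text \<open>Dividing the increment estimate by \<open>s - t\<close> turns increments of \<open>x\<close> and \<open>y\<close> into difference quotients, and the
  term quadratic in the increments retains a factor \<open>s - t\<close>, so the limit exists although \<open>x'\<close> need not be
  differentiable.\<close>

lemma energy_rate:
  assumes t: "0 \<le> t"
  shows "right_rate_le energy t (- decay * (speed t)\<^sup>2)"
proof -
  have right: "at t within {t<..} \<le> at t within {0..}" by (rule at_le) (use t in auto)
  have quot: "((\<lambda>s. (1 / (s - t)) *\<^sub>R (u s - u t)) \<longlongrightarrow> u') (at_right t)"
    if "(u has_vector_derivative u') (at t within {0..})" for u and u' :: 'a
  proof -
    have "((\<lambda>s. (1 / norm (s - t)) *\<^sub>R (u s - (u t + (s - t) *\<^sub>R u'))) \<longlongrightarrow> 0) (at_right t)"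
      using that unfolding has_vector_derivative_def has_derivative_within
      by (intro tendsto_mono[OF right]) simp
    from tendsto_add[OF this tendsto_const[of u']]
    have "((\<lambda>s. (1 / norm (s - t)) *\<^sub>R (u s - (u t + (s - t) *\<^sub>R u')) + u') \<longlongrightarrow> u') (at_right t)"
      by simp
    moreover have "\<forall>\<^sub>F s in at_right t. (1 / norm (s - t)) *\<^sub>R (u s - (u t + (s - t) *\<^sub>R u')) + u'
        = (1 / (s - t)) *\<^sub>R (u s - u t)"
      unfolding eventually_at_filter
      by (intro always_eventually allI impI) (simp add: scaleR_diff_right scaleR_add_right)
    ultimately show ?thesis by (rule Lim_transform_eventually)
  qed
  have lim: "(u \<longlongrightarrow> u t) (at_right t)" if "continuous_on {0..} u" for u :: "real \<Rightarrow> 'a"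
    using that t tendsto_mono[OF right] unfolding continuous_on_def by auto
  define qx qy where "qx s = (1 / (s - t)) *\<^sub>R (x s - x t)"
    and "qy s = (1 / (s - t)) *\<^sub>R (y s - y t)" for s
  let ?X = "tderiv x" and ?Y = "tderiv y"
  define B where "B s = (L * norm (?X s) + norm (?Y s) / \<gamma>)
            * (K * norm (x s - x t) + b * norm (y s - y t))
          - 1 / \<gamma> * (?X s \<bullet> (x s - x t))
          - 1 / (\<gamma> * a) * (?Y s \<bullet> (a *\<^sub>R (x s - x t) + b *\<^sub>R (y s - y t)))
          + L * (K * norm (x s - x t) + b * norm (y s - y t))\<^sup>2" for s
  define R where "R s = (L * norm (?X s) + norm (?Y s) / \<gamma>) * (K * norm (qx s) + b * norm (qy s))
          - 1 / \<gamma> * (?X s \<bullet> qx s)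
          - 1 / (\<gamma> * a) * (?Y s \<bullet> (a *\<^sub>R qx s + b *\<^sub>R qy s))
          + L * ((s - t) * (K * norm (qx s) + b * norm (qy s))\<^sup>2)" for s
  define l where "l = (L * norm (?X t) + norm (?Y t) / \<gamma>) * (K * norm (?X t) + b * norm (?Y t))
          - 1 / \<gamma> * (?X t \<bullet> ?X t) - 1 / (\<gamma> * a) * (?Y t \<bullet> (a *\<^sub>R ?X t + b *\<^sub>R ?Y t))
          + L * ((t - t) * (K * norm (?X t) + b * norm (?Y t))\<^sup>2)"
  have qx: "(qx \<longlongrightarrow> ?X t) (at_right t)" and qy: "(qy \<longlongrightarrow> ?Y t) (at_right t)"
    unfolding qx_def qy_def using t by (auto intro!: quot deriv_x deriv_y)
  have "(R \<longlongrightarrow> l) (at_right t)"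
    unfolding R_def l_def using pos
    by (intro tendsto_intros qx qy lim[OF cont_x'] lim[OF cont_y']) auto
  moreover have "B s / (s - t) = R s" if "t < s" for s
  proof -
    define k where "k = s - t"
    have k: "0 < k" and X1: "x s - x t = k *\<^sub>R qx s" and Y1: "y s - y t = k *\<^sub>R qy s"
      using that by (auto simp: k_def qx_def qy_def)
    show ?thesis
      unfolding B_def R_def X1 Y1 k_def[symmetric]
      using k pos by (simp add: inner_add_right field_simps power2_eq_square)
  qed
  then have "\<forall>\<^sub>F s in at_right t. R s = B s / (s - t)"
    unfolding eventually_at_filter by (intro always_eventually) auto
  ultimately have lim_B: "((\<lambda>s. B s / (s - t)) \<longlongrightarrow> l) (at_right t)"
    by (rule Lim_transform_eventually)
  have "- (?Y t \<bullet> ?X t) \<le> norm (?X t) * norm (?Y t)"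
    using norm_cauchy_schwarz[of "- ?Y t" "?X t"] by (simp add: mult.commute)
  from dissipation[OF norm_ge_zero norm_ge_zero this]
  have "l \<le> - decay * (speed t)\<^sup>2"
    by (simp add: l_def speed_def inner_add_right power2_norm_eq_inner)
  then show ?thesis
    using energy_increment[OF t] lim_B unfolding B_def[symmetric] by (intro right_rate_leI)
qed

text \<open>Only \<open>f \<circ> p\<close> is not obviously continuous; its subgradients \<open>\<xi>\<close> depend continuously on time, so the
  closed graph lemma applies.\<close>

lemma cont_energy: "continuous_on {0..} energy"
proof -
  have "continuous_on {0..} (\<lambda>t. real_of_ereal (f (p t)))"
    unfolding continuous_on_sequentially
  proof (intro allI ballI impI, elim conjE)
    fix T :: "nat \<Rightarrow> real" and t :: real
    assume t: "t \<in> {0..}" and T: "\<forall>n. T n \<in> {0..}" "T \<longlonglongrightarrow> t"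
    have T_nonneg: "0 \<le> T n" for n using T(1) by simp
    have "(\<lambda>n. p (T n)) \<longlonglongrightarrow> p t" and "(\<lambda>n. \<xi> (T n)) \<longlonglongrightarrow> \<xi> t"
      using t T(1) continuous_on_tendsto_compose[OF cont_p T(2)] continuous_on_tendsto_compose[OF cont_\<xi> T(2)]
      by simp_all
    then show "((\<lambda>t. real_of_ereal (f (p t))) \<circ> T) \<longlonglongrightarrow> real_of_ereal (f (p t))"
      unfolding o_def by (rule convex_subgradient_closed(2)[OF f(1,3) subgradient_p[OF T_nonneg]])
  qed
  then show ?thesis
    unfolding energy_def
    by (intro continuous_intros cont_x' cont_y' continuous_on_compose2[OF cont_\<Phi>[of UNIV] cont_p]) auto
qed

lemma energy_decrease:
  assumes "0 \<le> s" "s \<le> t"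
  shows "energy t + integral {s..t} (\<lambda>t. decay * (speed t)\<^sup>2) \<le> energy s"
proof (rule decrease_by_integral[OF assms(2)])
  show "continuous_on {s..t} energy" and "continuous_on {s..t} (\<lambda>t. decay * (speed t)\<^sup>2)"
    using assms by (auto intro!: continuous_intros continuous_on_subset[OF cont_energy]
        continuous_on_subset[OF cont_speed])
next
  fix t' assume "s \<le> t'"
  then show "right_rate_le energy t' (- (decay * (speed t')\<^sup>2))" using energy_rate[of t'] assms by simp
qed

lemma energy_antimono:
  assumes "0 \<le> s" "s \<le> t" shows "energy t \<le> energy s"
proof -
  have "0 \<le> integral {s..t} (\<lambda>t. decay * (speed t)\<^sup>2)"
    using decay_pos by (intro Henstock_Kurzweil_Integration.integral_nonneg integrable_continuous_interval
        continuous_intros continuous_on_subset[OF cont_speed]) (use assms in auto)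
  then show ?thesis using energy_decrease[OF assms] by simp
qed

section \<open>Asymptotics of the trajectory\<close>

text \<open>The energy never exceeds its initial value, and it bounds the kinetic terms because \<open>f + \<Phi>\<close> is bounded below.\<close>

lemma speed_bounded:
  "\<exists>R\<ge>0. \<forall>t\<ge>0. speed t \<le> R"
proof -
  define D where "D = energy 0 - m"
  have "norm (tderiv x t) \<le> sqrt (2 * \<gamma> * D)" "norm (tderiv y t) \<le> sqrt (2 * \<gamma> * a * D)"
    if t: "0 \<le> t" for t
  proof -
    have *: "1 / (2 * \<gamma>) * (norm (tderiv x t))\<^sup>2 + 1 / (2 * \<gamma> * a) * (norm (tderiv y t))\<^sup>2 \<le> D"
      using lower_energy[OF t] energy_antimono[of 0 t] t by (simp add: D_def)
    have "0 \<le> 1 / (2 * \<gamma> * a) * (norm (tderiv y t))\<^sup>2" "0 \<le> 1 / (2 * \<gamma>) * (norm (tderiv x t))\<^sup>2"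
      using pos by auto
    with * have "1 / (2 * \<gamma>) * (norm (tderiv x t))\<^sup>2 \<le> D" "1 / (2 * \<gamma> * a) * (norm (tderiv y t))\<^sup>2 \<le> D"
      by linarith+
    then have "(norm (tderiv x t))\<^sup>2 \<le> 2 * \<gamma> * D" "(norm (tderiv y t))\<^sup>2 \<le> 2 * \<gamma> * a * D"
      using pos by (simp_all add: pos_divide_le_eq mult.commute)
    then show "norm (tderiv x t) \<le> sqrt (2 * \<gamma> * D)" "norm (tderiv y t) \<le> sqrt (2 * \<gamma> * a * D)"
      by (simp_all add: real_le_rsqrt)
  qed
  then have "speed t \<le> sqrt (2 * \<gamma> * D) + sqrt (2 * \<gamma> * a * D)" if "0 \<le> t" for t
    using that unfolding speed_def by (intro add_mono)
  moreover from this[of 0] have "0 \<le> sqrt (2 * \<gamma> * D) + sqrt (2 * \<gamma> * a * D)"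
    using speed_nonneg[of 0] by simp
  ultimately show ?thesis by blast
qed

lemma increments_le_length:
  assumes "0 \<le> s" "s \<le> t"
  shows "norm (x t - x s) \<le> integral {s..t} speed" and "norm (y t - y s) \<le> integral {s..t} speed"
proof -
  have sub: "{s..t} \<subseteq> {0..}" using assms by auto
  show "norm (x t - x s) \<le> integral {s..t} speed"
    by (rule norm_diff_le_integral_speed[OF assms(2) _ continuous_on_subset[OF cont_x' sub]
          continuous_on_subset[OF cont_speed sub]])
       (use assms sub in \<open>auto simp: speed_def intro: has_vector_derivative_within_subset[OF deriv_x]\<close>)
  show "norm (y t - y s) \<le> integral {s..t} speed"
    by (rule norm_diff_le_integral_speed[OF assms(2) _ continuous_on_subset[OF cont_y' sub]
          continuous_on_subset[OF cont_speed sub]])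
       (use assms sub in \<open>auto simp: speed_def intro: has_vector_derivative_within_subset[OF deriv_y]\<close>)
qed

lemma p_increment_le_length:
  assumes "0 \<le> s" "s \<le> t"
  shows "norm (p t - p s) \<le> (K + b) * integral {s..t} speed"
proof -
  have "norm (p t - p s) \<le> K * norm (x t - x s) + b * norm (y t - y s)"
    using assms by (intro p_increment) auto
  also have "\<dots> \<le> K * integral {s..t} speed + b * integral {s..t} speed"
    using increments_le_length[OF assms] K_nonneg pos by (intro add_mono mult_left_mono) auto
  finally show ?thesis by (simp add: algebra_simps)
qed

text \<open>The speed is Lipschitz by the increment bounds and its square has bounded integrals by
  the dissipation of energy.\<close>

lemma speed_tendsto_0: "(speed \<longlongrightarrow> 0) at_top"
proof -
  obtain R where R: "0 \<le> R" "\<And>t. 0 \<le> t \<Longrightarrow> speed t \<le> R" using speed_bounded by blast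
  define \<Lambda> where "\<Lambda> = (K + b + 1 + a + b) * R"
  have r_Lip: "\<bar>speed t - speed s\<bar> \<le> \<Lambda> * (t - s)" if st: "0 \<le> s" "s \<le> t" for s t
  proof -
    have t0: "0 \<le> t" using st by simp
    let ?I = "integral {s..t} speed"
    have "?I \<le> integral {s..t} (\<lambda>_. R)"
      using st R by (intro integral_le integrable_continuous_interval continuous_on_subset[OF cont_speed]) auto
    then have I: "?I \<le> R * (t - s)" using st by (simp add: mult.commute)
    have "tderiv x t - tderiv x s = (p t - p s) - (x t - x s)" by (simp add: p_def)
    then have "norm (tderiv x t - tderiv x s) \<le> (K + b) * ?I + ?I"
      using norm_triangle_ineq4[of "p t - p s" "x t - x s"] p_increment_le_length[OF st]
        increments_le_length(1)[OF st] by simp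
    moreover have "tderiv y t - tderiv y s = - (a *\<^sub>R (x t - x s)) - b *\<^sub>R (y t - y s)"
      unfolding y'_eq[OF t0] y'_eq[OF st(1)] by (simp add: algebra_simps)
    then have "norm (tderiv y t - tderiv y s) \<le> a * norm (x t - x s) + b * norm (y t - y s)"
      using norm_triangle_ineq4[of "- (a *\<^sub>R (x t - x s))" "b *\<^sub>R (y t - y s)"] pos by simp
    moreover have "a * norm (x t - x s) + b * norm (y t - y s) \<le> a * ?I + b * ?I"
      using increments_le_length[OF st] pos by (intro add_mono mult_left_mono) auto
    moreover have "\<bar>speed t - speed s\<bar> \<le> norm (tderiv x t - tderiv x s) + norm (tderiv y t - tderiv y s)"
      using norm_triangle_ineq3[of "tderiv x t" "tderiv x s"] norm_triangle_ineq3[of "tderiv y t" "tderiv y s"]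
      unfolding speed_def by linarith
    ultimately have "\<bar>speed t - speed s\<bar> \<le> (K + b + 1 + a + b) * ?I" by (simp add: algebra_simps)
    also have "\<dots> \<le> (K + b + 1 + a + b) * (R * (t - s))"
      using I K_nonneg pos by (intro mult_left_mono) auto
    finally show ?thesis by (simp add: \<Lambda>_def mult.assoc)
  qed
  have "((\<lambda>t. (speed t)\<^sup>2) \<longlongrightarrow> 0) at_top"
  proof (rule vanishes_at_infinity_if_Lipschitz_and_integrals_bounded)
    fix s t :: real assume st: "0 \<le> s" "s \<le> t"
    have "\<bar>(speed t)\<^sup>2 - (speed s)\<^sup>2\<bar> = \<bar>speed t - speed s\<bar> * (speed t + speed s)"
      using speed_nonneg[of t] speed_nonneg[of s] by (simp add: power2_eq_square square_diff_square_factored abs_mult)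
    also have "\<dots> \<le> (\<Lambda> * (t - s)) * (2 * R)"
      using r_Lip[OF st] R(2)[of s] R(2)[of t] st speed_nonneg[of t] speed_nonneg[of s]
      by (intro mult_mono) auto
    finally show "\<bar>(speed t)\<^sup>2 - (speed s)\<^sup>2\<bar> \<le> (2 * R * \<Lambda>) * (t - s)" by (simp add: mult_ac)
  next
    show "continuous_on {0..} (\<lambda>t. (speed t)\<^sup>2)" by (intro continuous_intros cont_speed)
  next
    fix t :: real assume t: "0 \<le> t"
    have "m \<le> energy t"
      using lower_energy[OF t] pos by (smt (verit) divide_nonneg_pos mult_nonneg_nonneg mult_pos_pos zero_le_power2)
    then have "decay * integral {0..t} (\<lambda>t. (speed t)\<^sup>2) \<le> energy 0 - m"
      using energy_decrease[of 0 t] t by simp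
    then show "integral {0..t} (\<lambda>t. (speed t)\<^sup>2) \<le> (energy 0 - m) / decay"
      using decay_pos by (simp add: pos_le_divide_eq mult.commute)
  qed simp
  then have "((\<lambda>t. sqrt ((speed t)\<^sup>2)) \<longlongrightarrow> sqrt 0) at_top" by (rule tendsto_real_sqrt)
  then show ?thesis using speed_nonneg by simp
qed

lemma x'_tendsto_0: "(tderiv x \<longlongrightarrow> 0) at_top" and y'_tendsto_0: "(tderiv y \<longlongrightarrow> 0) at_top"
  by (rule Lim_null_comparison[OF _ speed_tendsto_0]; simp add: speed_def)+

text \<open>In the first component \<open>\<xi> + (p - x) / \<gamma>\<close> leaves \<open>y' / \<gamma> - grad\<Phi> x\<close>, whose gradient part
  combines with \<open>grad\<Phi> p\<close> to something of order \<open>\<bar>p - x\<bar> = \<bar>x'\<bar>\<close>; the other components are linear in \<open>x'\<close> and \<open>y'\<close>.\<close>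

lemma subgradient_along_trajectory_bounded_by_speed:
  "\<exists>M>0. \<forall>t\<ge>0. \<exists>V. V \<in> limiting_subdiff (regH a b \<gamma> f \<Phi>) (p t, x t, y t) \<and> norm V \<le> M * speed t"
proof -
  let ?M = "L + 1 / \<gamma> + 1 / \<gamma> + 1 / \<gamma> + b / (\<gamma> * a)"
  have M: "0 < ?M" using pos by (simp add: add_pos_pos)
  have "\<exists>V. V \<in> limiting_subdiff (regH a b \<gamma> f \<Phi>) (p t, x t, y t) \<and> norm V \<le> ?M * speed t"
    if t: "0 \<le> t" for t
  proof -
  let ?X = "tderiv x t" and ?Y = "tderiv y t"
  define V where "V = (grad\<Phi> (p t) - grad\<Phi> (x t) + (1 / \<gamma>) *\<^sub>R ?Y,
      - ((1 / \<gamma>) *\<^sub>R ?Y) - (1 / \<gamma>) *\<^sub>R ?X, - ((b / (\<gamma> * a)) *\<^sub>R ?Y))"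
  have "V = (\<xi> t + grad\<Phi> (p t) + (1 / \<gamma>) *\<^sub>R (p t - x t),
          (1 / \<gamma>) *\<^sub>R (a *\<^sub>R x t + b *\<^sub>R y t) - (1 / \<gamma>) *\<^sub>R (p t - x t),
          (b / (\<gamma> * a)) *\<^sub>R (a *\<^sub>R x t + b *\<^sub>R y t))"
  proof -
    have e: "a *\<^sub>R x t + b *\<^sub>R y t = - ?Y" using y'_eq[OF t] by simp
    show ?thesis unfolding e V_def \<xi>_def p_def by (simp add: algebra_simps)
  qed
  then have "V \<in> limiting_subdiff (regH a b \<gamma> f \<Phi>) (p t, x t, y t)"
    using frechet_subdiff_regH[OF f(1) subgradient_p[OF t] grad Lip pos(1,3,4)]
    by (simp add: limiting_subdiff_if_frechet)
  moreover have "norm V \<le> ?M * speed t"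
  proof -
    let ?n = "norm ?X" and ?k = "norm ?Y"
    have "norm V \<le> norm (grad\<Phi> (p t) - grad\<Phi> (x t) + (1 / \<gamma>) *\<^sub>R ?Y)
        + (norm (- ((1 / \<gamma>) *\<^sub>R ?Y) - (1 / \<gamma>) *\<^sub>R ?X) + norm (- ((b / (\<gamma> * a)) *\<^sub>R ?Y)))"
      unfolding V_def by (rule order_trans[OF norm_Pair_le add_left_mono[OF norm_Pair_le]])
    also have "norm (grad\<Phi> (p t) - grad\<Phi> (x t) + (1 / \<gamma>) *\<^sub>R ?Y) \<le> L * ?n + 1 / \<gamma> * ?k"
      using norm_triangle_ineq[of "grad\<Phi> (p t) - grad\<Phi> (x t)" "(1 / \<gamma>) *\<^sub>R ?Y"]
        Lip[of "p t" "x t"] pos by (simp add: p_def)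
    also have "norm (- ((1 / \<gamma>) *\<^sub>R ?Y) - (1 / \<gamma>) *\<^sub>R ?X) \<le> 1 / \<gamma> * ?k + 1 / \<gamma> * ?n"
      using norm_triangle_ineq4[of "- ((1 / \<gamma>) *\<^sub>R ?Y)" "(1 / \<gamma>) *\<^sub>R ?X"] pos by simp
    also have "norm (- ((b / (\<gamma> * a)) *\<^sub>R ?Y)) = b / (\<gamma> * a) * ?k" using pos by simp
    finally have "norm V \<le> L * ?n + 1 / \<gamma> * ?k + (1 / \<gamma> * ?k + 1 / \<gamma> * ?n + b / (\<gamma> * a) * ?k)" by simp
    also have "\<dots> \<le> L * speed t + 1 / \<gamma> * speed t + (1 / \<gamma> * speed t + 1 / \<gamma> * speed t + b / (\<gamma> * a) * speed t)"
      using pos by (intro add_mono mult_left_mono) (auto simp: speed_def)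
    finally show ?thesis by (simp add: algebra_simps)
  qed
  ultimately show ?thesis by blast
  qed
  with M show ?thesis by blast
qed

text \<open>Everything needed by the finite length lemma is checked at one cluster point. There \<open>x'\<close> and \<open>y'\<close> vanish, so
  \<open>p\<close> and \<open>x\<close> share their limit, \<open>a x + b y = 0\<close> determines the limit of \<open>y\<close>, and the limit
  of \<open>\<xi>\<close> is \<open>- grad\<Phi> xbar\<close>.\<close>

lemma trajectory_converges:
  assumes x_bounded: "bounded (x ` {0..})" and KL: "KL_function (regH a b \<gamma> f \<Phi>)"
  shows "\<exists>B. \<forall>t\<ge>0. integral {0..t} speed \<le> B"
    and "\<exists>xbar \<in> crit (\<lambda>z. f z + ereal (\<Phi> z)).
            (x \<longlongrightarrow> xbar) at_top \<and> (y \<longlongrightarrow> - (a / b) *\<^sub>R xbar) at_top"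
proof -
  let ?H = "regH a b \<gamma> f \<Phi>"
  have "bounded (range (\<lambda>n. x (real n)))"
    using x_bounded by (rule bounded_subset) auto
  then obtain xbar \<sigma> where \<sigma>: "strict_mono \<sigma>" and x_lim: "((\<lambda>n. x (real n)) \<circ> \<sigma>) \<longlonglongrightarrow> xbar"
    using bounded_imp_convergent_subsequence by metis
  define T where "T k = real (\<sigma> k)" for k
  have T_nonneg: "0 \<le> T k" for k by (simp add: T_def)
  have T: "filterlim T at_top sequentially"
    unfolding T_def
    by (rule filterlim_compose[OF filterlim_real_sequentially filterlim_subseq[OF \<sigma>]])
  have xT: "(\<lambda>k. x (T k)) \<longlonglongrightarrow> xbar" using x_lim by (simp add: T_def o_def)
  have x'T: "(\<lambda>k. tderiv x (T k)) \<longlonglongrightarrow> 0" and y'T: "(\<lambda>k. tderiv y (T k)) \<longlonglongrightarrow> 0"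
    using filterlim_compose[OF x'_tendsto_0 T] filterlim_compose[OF y'_tendsto_0 T] by simp_all
  have pT: "(\<lambda>k. p (T k)) \<longlonglongrightarrow> xbar"
    using tendsto_add[OF xT x'T] by (simp add: p_def)
  define ybar where "ybar = - (a / b) *\<^sub>R xbar"
  have y_eq: "y t = - ((1 / b) *\<^sub>R tderiv y t) - (a / b) *\<^sub>R x t" if "0 \<le> t" for t
    unfolding y'_eq[OF that] using pos by (simp add: scaleR_add_right scaleR_diff_right)
  have "(\<lambda>k. - ((1 / b) *\<^sub>R tderiv y (T k)) - (a / b) *\<^sub>R x (T k)) \<longlonglongrightarrow> - ((1 / b) *\<^sub>R 0) - (a / b) *\<^sub>R xbar"
    by (intro tendsto_intros y'T xT)
  then have yT: "(\<lambda>k. y (T k)) \<longlonglongrightarrow> ybar"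
    using y_eq[OF T_nonneg] by (simp add: ybar_def)
  have "(\<lambda>k. grad\<Phi> (x (T k))) \<longlonglongrightarrow> grad\<Phi> xbar"
    using continuous_on_tendsto_compose[OF cont_grad[of UNIV] xT] by simp
  then have "(\<lambda>k. \<xi> (T k)) \<longlonglongrightarrow> (1 / \<gamma>) *\<^sub>R 0 - grad\<Phi> xbar - (1 / \<gamma>) *\<^sub>R 0"
    unfolding \<xi>_def by (intro tendsto_intros x'T y'T)
  then have \<xi>T: "(\<lambda>k. \<xi> (T k)) \<longlonglongrightarrow> - grad\<Phi> xbar" by simp
  note closed = convex_subgradient_closed[OF f(1,3) subgradient_p[OF T_nonneg] pT \<xi>T]
  obtain F where F: "f xbar = ereal F"
    using convex_subgradient_finite[OF f(1) closed(1)] by (cases "f xbar") auto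

  have critical: "xbar \<in> crit (\<lambda>z. f z + ereal (\<Phi> z))"
  proof -
    have "0 \<in> frechet_subdiff (\<lambda>z. f z + ereal (\<Phi> z)) xbar"
    proof (rule frechet_subdiff_if_quadratic_minorant)
      fix u
      have "\<Phi> xbar + grad\<Phi> xbar \<bullet> (u - xbar) - L * (norm (u - xbar))\<^sup>2 \<le> \<Phi> u"
        using first_order_error[OF grad Lip, of u xbar] by linarith
      moreover have "f xbar + ereal (- grad\<Phi> xbar \<bullet> (u - xbar)) \<le> f u"
        using closed(1) unfolding convex_subgradient_def by blast
      ultimately show "f xbar + ereal (\<Phi> xbar) + ereal (0 \<bullet> (u - xbar) - L * (norm (u - xbar))\<^sup>2)
          \<le> f u + ereal (\<Phi> u)"
        using F by (cases "f u") auto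
    qed (use F in simp)
    then show ?thesis unfolding crit_def by (simp add: limiting_subdiff_if_frechet)
  qed

  define Einf where "Einf = F + \<Phi> xbar"
  have ET: "(\<lambda>k. energy (T k)) \<longlonglongrightarrow> Einf"
  proof -
    have "(\<lambda>k. \<Phi> (p (T k))) \<longlonglongrightarrow> \<Phi> xbar"
      using continuous_on_tendsto_compose[OF cont_\<Phi>[of UNIV] pT] by simp
    then have "(\<lambda>k. energy (T k)) \<longlonglongrightarrow> real_of_ereal (f xbar) + \<Phi> xbar
        + 1 / (2 * \<gamma>) * (norm (0::'a))\<^sup>2 + 1 / (2 * \<gamma> * a) * (norm (0::'a))\<^sup>2"
      unfolding energy_def by (intro tendsto_intros closed(2) x'T y'T)
    then show ?thesis by (simp add: F Einf_def)
  qed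
  have T_large: "\<exists>k. t \<le> T k \<and> P k" if "\<forall>\<^sub>F k in sequentially. P k" for t P
    using eventually_happens'[OF sequentially_bot eventually_conj[OF _ that]] T
    unfolding filterlim_at_top by blast
  have energy_lower: "Einf \<le> energy t" if "0 \<le> t" for t
  proof (rule ccontr)
    assume "\<not> Einf \<le> energy t"
    then have "\<forall>\<^sub>F k in sequentially. energy t < energy (T k)"
      using order_tendstoD(1)[OF ET] by simp
    then obtain k where "t \<le> T k" "energy t < energy (T k)" using T_large by blast
    then show False using energy_antimono[OF that] by fastforce
  qed
  define h where "h t = energy t - Einf" for t
  have h_lim: "(h \<longlongrightarrow> 0) at_top"
  proof (rule order_tendstoI)
    fix e :: real assume "e < 0"
    then have "e < h t" if "0 \<le> t" for t using energy_lower[OF that] by (simp add: h_def)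
    then show "\<forall>\<^sub>F t in at_top. e < h t" unfolding eventually_at_top_linorder by blast
  next
    fix e :: real assume "0 < e"
    then have "\<forall>\<^sub>F k in sequentially. energy (T k) < Einf + e" using ET by (intro order_tendstoD(2)) auto
    then obtain k where k: "energy (T k) < Einf + e" using T_large by blast
    have "h t < e" if "T k \<le> t" for t
      using energy_antimono[OF T_nonneg that] k by (simp add: h_def)
    then show "\<forall>\<^sub>F t in at_top. h t < e" unfolding eventually_at_top_linorder by blast
  qed

  define z where "z = (xbar, xbar, ybar)"
  define Z where "Z t = (p t, x t, y t)" for t
  have "a *\<^sub>R xbar + b *\<^sub>R ybar = 0" using pos by (simp add: ybar_def)
  then have Hz: "?H z = ereal Einf" by (simp add: z_def regH_def F Einf_def)
  have "limiting_subdiff ?H z \<noteq> {}"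
    using limiting_subdiff_if_frechet[OF
        frechet_subdiff_regH[OF f(1) closed(1) grad Lip pos(1,3,4), of xbar b ybar]]
    unfolding z_def by blast
  then have KLz: "KL_property_at ?H z" using KL unfolding KL_function_def by blast
  obtain \<eta> U \<phi> where \<eta>: "0 < \<eta>" and U: "open U" "z \<in> U" and \<phi>: "\<phi> \<in> KL_Theta \<eta>"
    and KL_ineq: "\<forall>u\<in>U. \<forall>V\<in>limiting_subdiff ?H u. \<forall>h. ?H u = ereal (Einf + h) \<longrightarrow> 0 < h \<longrightarrow>
        ereal h < \<eta> \<longrightarrow> 1 \<le> deriv \<phi> h * norm V"
    using KL_property_at_real[where g = ?H and z = z and G = Einf, OF KLz Hz]
    by (elim exE conjE) (rule that)
  obtain M where M: "0 < M" "\<forall>t\<ge>0. \<exists>V. V \<in> limiting_subdiff ?H (p t, x t, y t) \<and> norm V \<le> M * speed t"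
    using subgradient_along_trajectory_bounded_by_speed by (elim exE conjE) (rule that)

  have C_pos: "0 < K + b + 2" using K_nonneg pos by simp
  have h_cont: "continuous_on {0..} h" unfolding h_def by (intro continuous_intros cont_energy)
  have h_nonneg: "\<And>t. 0 \<le> t \<Longrightarrow> 0 \<le> h t" using energy_lower by (simp add: h_def)
  have h_rate: "\<And>t. 0 \<le> t \<Longrightarrow> right_rate_le h t (- decay * (speed t)\<^sup>2)"
    using energy_rate unfolding right_rate_le_def h_def by simp
  have Z_length: "dist (Z s) (Z t) \<le> (K + b + 2) * integral {s..t} speed" if st: "0 \<le> s" "s \<le> t" for s t
  proof -
    have "dist (Z s) (Z t) = norm (p t - p s, x t - x s, y t - y s)"
      by (subst dist_commute) (simp add: Z_def dist_norm)
    also have "\<dots> \<le> norm (p t - p s) + (norm (x t - x s) + norm (y t - y s))"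
      by (rule order_trans[OF norm_Pair_le add_left_mono[OF norm_Pair_le]])
    also have "\<dots> \<le> (K + b + 2) * integral {s..t} speed"
      using p_increment_le_length[OF st] increments_le_length[OF st] by (simp add: algebra_simps)
    finally show ?thesis .
  qed
  have ZT: "(\<lambda>k. Z (T k)) \<longlonglongrightarrow> z"
    unfolding Z_def z_def by (intro tendsto_Pair pT xT yT)
  have cluster: "\<exists>t\<ge>t0. dist (Z t) z < \<epsilon>" if "0 < \<epsilon>" for \<epsilon> t0
  proof -
    have "\<forall>\<^sub>F k in sequentially. dist (Z (T k)) z < \<epsilon>" using ZT that by (rule tendstoD)
    then show ?thesis using T_large by blast
  qed
  have speed_bound: "1 \<le> deriv \<phi> (h t) * (M * speed t)"
    if t: "0 \<le> t" "Z t \<in> U" and ht: "0 < h t" "ereal (h t) < \<eta>" for t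
  proof -
    obtain V where V: "V \<in> limiting_subdiff ?H (Z t)" "norm V \<le> M * speed t" using M(2) t(1) unfolding Z_def by blast
    have HZ: "?H (Z t) = ereal (Einf + h t)" using regH_eq_energy[OF t(1)] by (simp add: Z_def h_def)
    have "1 \<le> deriv \<phi> (h t) * norm V" by (rule KL_ineq[rule_format, OF t(2) V(1) HZ ht])
    also have "\<dots> \<le> deriv \<phi> (h t) * (M * speed t)"
      using V(2) \<phi> ht unfolding KL_Theta_def by (intro mult_left_mono) (auto simp: less_imp_le)
    finally show ?thesis .
  qed
  note length = KL_finite_length[OF decay_pos M(1) C_pos cont_speed speed_nonneg h_cont h_nonneg h_lim h_rate
      Z_length cluster U \<eta> \<phi> speed_bound]
  show "\<exists>B. \<forall>t\<ge>0. integral {0..t} speed \<le> B" using length(2) .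
  have "((\<lambda>t. fst (snd (Z t))) \<longlongrightarrow> fst (snd z)) at_top" "((\<lambda>t. snd (snd (Z t))) \<longlongrightarrow> snd (snd z)) at_top"
    using length(1) by (intro tendsto_fst tendsto_snd; assumption)+
  then show "\<exists>xbar \<in> crit (\<lambda>z. f z + ereal (\<Phi> z)).
            (x \<longlongrightarrow> xbar) at_top \<and> (y \<longlongrightarrow> - (a / b) *\<^sub>R xbar) at_top"
    using critical unfolding Z_def z_def ybar_def by auto
qed

end

theorem theorem11:
  fixes f :: "real ^ 'n \<Rightarrow> ereal"
    and \<Phi> :: "real ^ 'n \<Rightarrow> real"
    and grad\<Phi> :: "real ^ 'n \<Rightarrow> real ^ 'n"
    and a b \<gamma> L :: real
    and x\<^sub>0 y\<^sub>0 :: "real ^ 'n"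
    and x y :: "real \<Rightarrow> real ^ 'n"
  assumes pos: "a > 0" "b > 0" "\<gamma> > 0" "L > 0"
    and f: "proper_fun f" "convex_fun f" "lsc_fun f"
    and grad: "\<And>z. GDERIV \<Phi> z :> grad\<Phi> z"
    and Lip: "\<And>z z'. norm (grad\<Phi> z - grad\<Phi> z') \<le> L * norm (z - z')"
    and bounded_below: "\<exists>m::real. \<forall>z. ereal m \<le> f z + ereal (\<Phi> z)"
    and params1: "2 * \<gamma> * L * (\<bar>1 - a\<bar> + \<gamma> * L) + \<bar>1 - a\<bar> + \<gamma> * L + b * \<gamma> * L < 1"
    and params2: "a * b + a / 2 + 1 / 2 * a * \<bar>1 - a\<bar> + 1 / 2 * \<gamma> * a * L
                    + 1 / 2 * \<gamma> * a * b * L < b"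
    and sol: "global_solution a b \<gamma> f grad\<Phi> x\<^sub>0 y\<^sub>0 x y"
    and x_bounded: "bounded (x ` {0..})"
    and KL: "KL_function (regH a b \<gamma> f \<Phi>)"
  shows "(tderiv x absolutely_integrable_on {0..} \<and>
          tderiv y absolutely_integrable_on {0..} \<and>
          (\<lambda>t. a *\<^sub>R x t + b *\<^sub>R y t) absolutely_integrable_on {0..} \<and>
          (tderiv x \<longlongrightarrow> 0) at_top \<and>
          (tderiv y \<longlongrightarrow> 0) at_top \<and>
          ((\<lambda>t. a *\<^sub>R x t + b *\<^sub>R y t) \<longlongrightarrow> 0) at_top) \<and>
         (\<exists>xbar \<in> crit (\<lambda>z. f z + ereal (\<Phi> z)).
            (x \<longlongrightarrow> xbar) at_top \<and>
            (y \<longlongrightarrow> - (a / b) *\<^sub>R xbar) at_top)"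
proof -
  obtain m where m: "\<And>z. ereal m \<le> f z + ereal (\<Phi> z)" using bounded_below by blast
  interpret prox_flow f \<Phi> grad\<Phi> a b \<gamma> L m x\<^sub>0 y\<^sub>0 x y
    using pos f grad Lip m params1 params2 sol by unfold_locales
  obtain B where B: "\<And>t. 0 \<le> t \<Longrightarrow> integral {0..t} speed \<le> B"
    using trajectory_converges(1)[OF x_bounded KL] by blast
  have "tderiv x absolutely_integrable_on {0..}"
    by (rule absolutely_integrable_if_speed_integrals_bounded[OF cont_x' cont_speed _ B])
       (simp_all add: speed_def)
  moreover have "tderiv y absolutely_integrable_on {0..}"
    by (rule absolutely_integrable_if_speed_integrals_bounded[OF cont_y' cont_speed _ B])
       (simp_all add: speed_def)
  moreover have z: "a *\<^sub>R x t + b *\<^sub>R y t = - tderiv y t" if "0 \<le> t" for t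
    using y'_eq[OF that] by simp
  have "(\<lambda>t. a *\<^sub>R x t + b *\<^sub>R y t) absolutely_integrable_on {0..}"
    by (rule absolutely_integrable_if_speed_integrals_bounded[OF _ cont_speed _ B])
       (auto simp: z speed_def intro!: continuous_intros cont_x cont_y)
  moreover have "((\<lambda>t. - tderiv y t) \<longlongrightarrow> 0) at_top"
    using tendsto_minus[OF y'_tendsto_0] by simp
  then have "((\<lambda>t. a *\<^sub>R x t + b *\<^sub>R y t) \<longlongrightarrow> 0) at_top"
    by (rule Lim_transform_eventually)
       (use z in \<open>auto simp: eventually_at_top_linorder intro!: exI[of _ 0]\<close>)
  ultimately show ?thesis
    using x'_tendsto_0 y'_tendsto_0 trajectory_converges(2)[OF x_bounded KL] by blast
qed

end
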